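(* Let $p$ be a complex polynomial belonging to one of the following classes: (i) polynomials having exactly two distinct roots; (ii) unicritical polynomials, i.e. polynomials of the form $p(z)=(z-\alpha)^n+\beta$ with $\alpha,\beta\in\mathbb{C}$, $\beta\neq 0$, $n\ge 2$; (iii) polynomials of the form $p(z)=(az+b)^m\big[(az+b)^n+c\big]$, where $a,b,c\in\mathbb{C}$, $a\neq 0$, $c\neq 0$, and $m,n\in\mathbb{N}$ with $n\ge 2$. Then the relaxed Newton's method is $h$-convergent for $p$: for every admissible relaxation parameter $h$ (that is, every $h\in\mathbb{C}$ with $|h-\mu|<\mu$, where $\mu$ is the least multiplicity among the roots of $p$), the Fatou set of $N_{h,p}$ consists precisely of the union of the basins of attraction of the roots of $p$.
   Context: For a complex polynomial $p$ with at least two distinct roots and $h\in\mathbb{C}\setminus\{0\}$, the relaxed Newton map is the rational map $N_{h,p}(z)=z-h\,\frac{p(z)}{p'(z)}$ on the Riemann sphere. A root of $p$ of multiplicity $\mu_0$ is a fixed point of $N_{h,p}$ with multiplier $1-h/\mu_0$; the relaxation parameter is called admissible if every root is an attracting fixed point, i.e. $|h-\mu|<\mu$ where $\mu$ is the least root multiplicity. For an attracting fixed point $z_0$, its basin is $\{z:\lim_{k\to\infty}N_{h,p}^k(z)=z_0\}$. The method is called convergent for $p$ (and parameter $h$) if the Fatou set of $N_{h,p}$ equals the union of the basins of the roots of $p$; it is $h$-convergent if it is convergent for every admissible $h$. *)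

theory Defs
  imports "HOL-Analysis.Analysis" "HOL-Computational_Algebra.Polynomial_Factorial" "HOL-Computational_Algebra.Field_as_Ring"
begin

text \<open>The Riemann sphere is modelled as complex option: Some z is the finite
point z, None is the point at infinity.  It carries the chordal metric.\<close>

type_synonym sphere = "complex option"

fun chordal :: "sphere \<Rightarrow> sphere \<Rightarrow> real" where
  "chordal (Some z) (Some w) =
     2 * cmod (z - w) / (sqrt (1 + (cmod z)\<^sup>2) * sqrt (1 + (cmod w)\<^sup>2))"
| "chordal None (Some w) = 2 / sqrt (1 + (cmod w)\<^sup>2)"
| "chordal (Some z) None = 2 / sqrt (1 + (cmod z)\<^sup>2)"
| "chordal None None = 0"

definition sph_open :: "sphere set \<Rightarrow> bool" where
  "sph_open U \<longleftrightarrow> (\<forall>x\<in>U. \<exists>e>0. \<forall>y. chordal x y < e \<longrightarrow> y \<in> U)"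

definition locunif_conv :: "(nat \<Rightarrow> sphere \<Rightarrow> sphere) \<Rightarrow> (sphere \<Rightarrow> sphere) \<Rightarrow> sphere set \<Rightarrow> bool" where
  "locunif_conv fs g U \<longleftrightarrow>
     (\<forall>x\<in>U. \<exists>e>0. \<forall>\<epsilon>>0. \<exists>N. \<forall>n\<ge>N. \<forall>y\<in>U. chordal x y < e \<longrightarrow> chordal (fs n y) (g y) < \<epsilon>)"

definition normal_family :: "(sphere \<Rightarrow> sphere) set \<Rightarrow> sphere set \<Rightarrow> bool" where
  "normal_family F U \<longleftrightarrow>
     (\<forall>s::nat \<Rightarrow> sphere \<Rightarrow> sphere. (\<forall>n. s n \<in> F) \<longrightarrow> (\<exists>r g. strict_mono r \<and> locunif_conv (s \<circ> r) g U))"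

definition fatou_set :: "(sphere \<Rightarrow> sphere) \<Rightarrow> sphere set" where
  "fatou_set f = {z. \<exists>U. sph_open U \<and> z \<in> U \<and> normal_family (range (\<lambda>k. f ^^ k)) U}"

definition basin :: "(sphere \<Rightarrow> sphere) \<Rightarrow> sphere \<Rightarrow> sphere set" where
  "basin f z0 = {z. \<forall>\<epsilon>>0. \<exists>N. \<forall>k\<ge>N. chordal ((f ^^ k) z) z0 < \<epsilon>}"

definition rat_map :: "complex poly \<Rightarrow> complex poly \<Rightarrow> sphere \<Rightarrow> sphere" where
  "rat_map P Q w =
    (let g = gcd P Q; P' = P div g; Q' = Q div g in
     case w of
       Some z \<Rightarrow> (if poly Q' z = 0 then None else Some (poly P' z / poly Q' z))
     | None \<Rightarrow> (if degree P' > degree Q' then None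
                else if degree P' < degree Q' then Some 0
                else Some (lead_coeff P' / lead_coeff Q')))"

text \<open>Relaxed Newton map N(z) = z - h p(z)/p'(z) = (z p'(z) - h p(z)) / p'(z).\<close>
definition relaxed_newton :: "complex \<Rightarrow> complex poly \<Rightarrow> sphere \<Rightarrow> sphere" where
  "relaxed_newton h p = rat_map ([:0, 1:] * pderiv p - smult h p) (pderiv p)"

definition roots :: "complex poly \<Rightarrow> complex set" where
  "roots p = {z. poly p z = 0}"

definition min_mult :: "complex poly \<Rightarrow> nat" where
  "min_mult p = Min ((\<lambda>z. order z p) ` roots p)"

definition admissible :: "complex poly \<Rightarrow> complex \<Rightarrow> bool" where
  "admissible p h \<longleftrightarrow> cmod (h - of_nat (min_mult p)) < of_nat (min_mult p)"

definition convergent_for :: "complex poly \<Rightarrow> complex \<Rightarrow> bool" where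
  "convergent_for p h \<longleftrightarrow>
     fatou_set (relaxed_newton h p) = (\<Union>z\<in>roots p. basin (relaxed_newton h p) (Some z))"

definition h_convergent :: "complex poly \<Rightarrow> bool" where
  "h_convergent p \<longleftrightarrow> (\<forall>h. admissible p h \<longrightarrow> convergent_for p h)"

end

theory Submission
  imports Defs "HOL-Complex_Analysis.Complex_Analysis"
    "HOL-Computational_Algebra.Fundamental_Theorem_Algebra"
begin

text \<open>
  In reduced form the relaxed Newton map is \<open>N = P / Q\<close> with \<open>degree Q < degree P\<close>; infinity is a
  repelling fixed point and the roots of \<open>p\<close> are attracting ones. Over the complement of the finite
  set of critical values \<open>N\<close> is a covering, so inverse branches of all iterates exist on convex
  domains that avoid the forward orbits of the critical values.

  If every critical value lies in some basin, the Fatou set is the union of the basins. A Fatou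
  point outside the basins would have a disc \<open>B\<close> outside the basins around it. Infinity being
  repelling, the orbit of a point of \<open>B\<close> accumulates at some finite \<open>w\<close> outside the basins. Follow a
  segment from \<open>w\<close> to the first point where it meets the closure of the basins: a thin neighbourhood
  of this segment avoids the critical orbits. The inverse branches on it along the orbit omit a
  disc around a root, and by Montel's theorem they have a limit, which takes values outside the
  basins only. This contradicts the open mapping theorem, or, if the limit is constant, the choice
  of \<open>B\<close>, because the inverse branches map some points into the basins.

  By Fatou's argument every basin contains a critical value, and in the three classes of
  polynomials counting shows that no critical value is left over: with two roots there are at most
  two critical values, and in the other classes the critical values form, up to the rotations that
  commute with \<open>N\<close>, at most as many classes as there are classes of roots.
\<close>

section \<open>The chordal metric\<close>

text \<open>Inverse stereographic projection onto the unit sphere, with infinity as the north pole.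
  Under it \<open>chordal\<close> becomes the Euclidean distance, and the metric axioms are
  inherited.\<close>

definition stereo :: "sphere \<Rightarrow> complex \<times> real" where
  "stereo x = (case x of None \<Rightarrow> (0, 1)
     | Some z \<Rightarrow> (of_real (2 / (1 + (cmod z)\<^sup>2)) * z, 1 - 2 / (1 + (cmod z)\<^sup>2)))"

lemma one_plus_sq_pos: "0 < 1 + (r::real)\<^sup>2"
  by (simp add: add_pos_nonneg)

text \<open>The law of cosines: the inner product of \<open>z\<close> and \<open>w\<close> is
  expressed through moduli, the only quantities that occur in \<open>chordal\<close>.\<close>

lemma cmod_scaled_diff:
  "(cmod (of_real s * z - of_real t * w))\<^sup>2 =
     s\<^sup>2 * (cmod z)\<^sup>2 + t\<^sup>2 * (cmod w)\<^sup>2 - s * t * ((cmod z)\<^sup>2 + (cmod w)\<^sup>2 - (cmod (z - w))\<^sup>2)"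
  unfolding cmod_power2 by (simp add: power2_eq_square algebra_simps)

lemma chordal_None_eq_dist_stereo: "chordal None (Some w) = dist (stereo None) (stereo (Some w))"
proof -
  define s where "s = 2 / (1 + (cmod w)\<^sup>2)"
  have s: "s > 0" "(cmod w)\<^sup>2 = 2 / s - 1"
    using one_plus_sq_pos[of "cmod w"] by (simp_all add: s_def)
  have stereo: "stereo None = (0, 1)" "stereo (Some w) = (of_real s * w, 1 - s)"
    by (simp_all add: stereo_def s_def)
  have "(dist (stereo None) (stereo (Some w)))\<^sup>2 = s\<^sup>2 * (cmod w)\<^sup>2 + s\<^sup>2"
    unfolding stereo by (simp add: dist_prod_def dist_norm norm_mult power_mult_distrib)
  also have "\<dots> = 2 * s"
    unfolding s(2) using s(1) by (simp add: field_simps power2_eq_square)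
  also have "\<dots> = (chordal None (Some w))\<^sup>2"
    using one_plus_sq_pos[of "cmod w"] by (simp add: s_def power_divide)
  finally show ?thesis
    by (metis chordal.simps(2) one_plus_sq_pos power2_eq_imp_eq real_sqrt_ge_zero zero_le_dist
        less_imp_le divide_nonneg_nonneg zero_le_numeral)
qed

lemma chordal_eq_dist_stereo: "chordal x y = dist (stereo x) (stereo y)"
proof (cases x; cases y)
  fix z w assume xy: "x = Some z" "y = Some w"
  let ?a = "1 + (cmod z)\<^sup>2" and ?b = "1 + (cmod w)\<^sup>2"
  have ab: "?a > 0" "?b > 0" by (rule one_plus_sq_pos)+
  define s t where "s = 2 / ?a" and "t = 2 / ?b"
  have sz: "(cmod z)\<^sup>2 = 2 / s - 1" "(cmod w)\<^sup>2 = 2 / t - 1"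
    using ab by (simp_all add: s_def t_def)
  have st: "s > 0" "t > 0" using ab by (simp_all add: s_def t_def)
  have stereo: "stereo x = (of_real s * z, 1 - s)" "stereo y = (of_real t * w, 1 - t)"
    by (simp_all add: xy stereo_def s_def t_def)
  have "(dist (stereo x) (stereo y))\<^sup>2 = (cmod (of_real s * z - of_real t * w))\<^sup>2 + (t - s)\<^sup>2"
    unfolding stereo by (simp add: dist_prod_def dist_norm)
  also have "\<dots> = s * t * (cmod (z - w))\<^sup>2"
    using st unfolding cmod_scaled_diff sz by (simp add: field_simps power2_eq_square)
  also have "\<dots> = (chordal x y)\<^sup>2"
    using ab by (simp add: xy s_def t_def power_divide power_mult_distrib)
  finally have "(chordal x y)\<^sup>2 = (dist (stereo x) (stereo y))\<^sup>2" by simp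
  moreover have "chordal x y \<ge> 0" by (simp add: xy)
  ultimately show ?thesis by (simp add: power2_eq_iff_nonneg)
next
  fix z assume "x = Some z" "y = None"
  then show ?thesis using chordal_None_eq_dist_stereo[of z] by (simp add: dist_commute)
qed (simp_all add: chordal_None_eq_dist_stereo del: chordal.simps(2))

lemma chordal_triangle: "chordal x z \<le> chordal x y + chordal y z"
  by (simp add: chordal_eq_dist_stereo dist_triangle)

lemma chordal_commute: "chordal x y = chordal y x"
  by (simp add: chordal_eq_dist_stereo dist_commute)

lemma chordal_self [simp]: "chordal x x = 0"
  by (simp add: chordal_eq_dist_stereo)

lemma chordal_Some_None_pos: "0 < chordal (Some z) None"
  by (simp add: one_plus_sq_pos)

lemma chordal_le_dist: "chordal (Some z) (Some w) \<le> 2 * dist z w"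
proof -
  have "1 \<le> sqrt (1 + (cmod z)\<^sup>2) * sqrt (1 + (cmod w)\<^sup>2)"
    using mult_mono[of 1 "sqrt (1 + (cmod z)\<^sup>2)" 1 "sqrt (1 + (cmod w)\<^sup>2)"] by simp
  then have "2 * cmod (z - w) / (sqrt (1 + (cmod z)\<^sup>2) * sqrt (1 + (cmod w)\<^sup>2)) \<le> 2 * cmod (z - w) / 1"
    by (intro divide_left_mono) auto
  then show ?thesis by (simp add: dist_norm)
qed

lemma chordal_None_le: "w \<noteq> 0 \<Longrightarrow> chordal None (Some w) \<le> 2 / cmod w"
  by (auto intro!: divide_left_mono real_le_rsqrt simp: one_plus_sq_pos)

lemma chordal_None_less_imp:
  assumes "R > 0"
  obtains e where "e > 0" "\<And>w. chordal None (Some w) < e \<Longrightarrow> R < cmod w"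
proof
  show "2 / sqrt (1 + R\<^sup>2) > 0" by (simp add: one_plus_sq_pos)
  fix w assume "chordal None (Some w) < 2 / sqrt (1 + R\<^sup>2)"
  then have "sqrt (1 + R\<^sup>2) < sqrt (1 + (cmod w)\<^sup>2)"
    by (simp add: one_plus_sq_pos field_simps)
  then have "R\<^sup>2 < (cmod w)\<^sup>2" by simp
  then show "R < cmod w" by (rule power_less_imp_less_base) simp
qed

lemma chordal_Some_less_imp:
  assumes "\<delta> > 0"
  obtains e where "e > 0" "\<And>x. chordal (Some z) x < e \<Longrightarrow> \<exists>w. x = Some w \<and> dist z w < \<delta>"
proof
  define M where "M = sqrt (1 + (cmod z)\<^sup>2)"
  have M: "M \<ge> 1" "cmod z \<le> M" by (auto simp: M_def intro: real_le_rsqrt)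
  define D where "D = M * (1 + M + \<delta>)"
  have D: "D > 0" using M assms by (simp add: D_def)
  \<comment> \<open>\<open>2 / M\<close> is the chordal distance from \<open>Some z\<close> to
    infinity. The other bound works because t / (1 + M + t) increases in t, so for t at least
    \<delta> it is smallest at \<delta>.\<close>
  define e where "e = min (2 / M) (2 * \<delta> / D)"
  show "e > 0" using M assms D by (simp add: e_def)
  fix x assume less: "chordal (Some z) x < e"
  show "\<exists>w. x = Some w \<and> dist z w < \<delta>"
  proof (cases x)
    case None
    then show ?thesis using less by (simp add: e_def M_def)
  next
    case (Some w)
    have "dist z w < \<delta>"
    proof (rule ccontr)
      assume far: "\<not> dist z w < \<delta>"
      let ?t = "cmod (z - w)"
      have "cmod w \<le> M + ?t"
        using norm_triangle_ineq2[of w z] M by (simp add: norm_minus_commute)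
      moreover have "sqrt (1 + (cmod w)\<^sup>2) \<le> 1 + cmod w"
        by (rule real_le_lsqrt) (auto simp: power2_eq_square algebra_simps)
      ultimately have s: "sqrt (1 + (cmod w)\<^sup>2) \<le> 1 + M + ?t" by linarith
      have "?t \<ge> \<delta>" using far by (simp add: dist_norm)
      then have "\<delta> * (1 + M + ?t) \<le> ?t * (1 + M + \<delta>)"
        using M mult_mono[of "\<delta>" ?t "1 + M" "1 + M"] assms by (simp add: algebra_simps)
      then have "\<delta> * (M * (1 + M + ?t)) \<le> ?t * D"
        using mult_left_mono[of _ _ M] M unfolding D_def by (smt (verit) mult.left_commute)
      moreover have "\<delta> * (M * sqrt (1 + (cmod w)\<^sup>2)) \<le> \<delta> * (M * (1 + M + ?t))"
        using s M assms by (intro mult_left_mono) auto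
      ultimately have "\<delta> * (M * sqrt (1 + (cmod w)\<^sup>2)) \<le> ?t * D" by linarith
      then have "2 * \<delta> / D \<le> 2 * ?t / (M * sqrt (1 + (cmod w)\<^sup>2))"
        using D M by (simp add: field_simps one_plus_sq_pos)
      then show False using less Some by (simp add: e_def M_def)
    qed
    with Some show ?thesis by blast
  qed
qed

section \<open>Continuity, open sets and basins on the sphere\<close>

definition sphere_cont :: "(sphere \<Rightarrow> sphere) \<Rightarrow> bool" where
  "sphere_cont f \<longleftrightarrow> (\<forall>x. \<forall>\<epsilon>>0. \<exists>\<delta>>0. \<forall>y. chordal x y < \<delta> \<longrightarrow> chordal (f x) (f y) < \<epsilon>)"

lemma sphere_cont_funpow: "sphere_cont f \<Longrightarrow> sphere_cont (f ^^ k)"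
proof (induction k)
  case (Suc k)
  show ?case
    unfolding sphere_cont_def
  proof (intro allI impI)
    fix x and \<epsilon> :: real assume "\<epsilon> > 0"
    then obtain \<delta>' where "\<delta>' > 0" and 1: "\<And>y. chordal ((f ^^ k) x) y < \<delta>' \<Longrightarrow> chordal (f ((f ^^ k) x)) (f y) < \<epsilon>"
      using Suc.prems unfolding sphere_cont_def by blast
    then obtain \<delta> where "\<delta> > 0" "\<And>y. chordal x y < \<delta> \<Longrightarrow> chordal ((f ^^ k) x) ((f ^^ k) y) < \<delta>'"
      using Suc.IH[OF Suc.prems] unfolding sphere_cont_def by blast
    then show "\<exists>\<delta>>0. \<forall>y. chordal x y < \<delta> \<longrightarrow> chordal ((f ^^ Suc k) x) ((f ^^ Suc k) y) < \<epsilon>"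
      using 1 by auto
  qed
qed (auto simp: sphere_cont_def)

lemma eventually_nhds_imp_chordal:
  assumes "eventually (\<lambda>w. p (Some w)) (nhds z)"
  shows "\<exists>\<delta>>0. \<forall>y. chordal (Some z) y < \<delta> \<longrightarrow> p y"
proof -
  obtain d where d: "d > 0" "\<And>w. dist w z < d \<Longrightarrow> p (Some w)"
    using assms by (auto simp: eventually_nhds_metric)
  obtain e where "e > 0" "\<And>x. chordal (Some z) x < e \<Longrightarrow> \<exists>w. x = Some w \<and> dist z w < d"
    using chordal_Some_less_imp[OF d(1), of z] by blast
  then show ?thesis using d by (metis dist_commute)
qed

lemma open_if_sph_open:
  assumes "sph_open U"
  shows "open {z. Some z \<in> U}"
  unfolding open_dist
proof (intro ballI)
  fix z assume "z \<in> {z. Some z \<in> U}"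
  then obtain e where "e > 0" "\<And>y. chordal (Some z) y < e \<Longrightarrow> y \<in> U"
    using assms unfolding sph_open_def by blast
  moreover have "chordal (Some z) (Some y) < e" if "dist y z < e / 2" for y
    using chordal_le_dist[of z y] that by (simp add: dist_commute del: chordal.simps)
  ultimately show "\<exists>e>0. \<forall>y. dist y z < e \<longrightarrow> y \<in> {z. Some z \<in> U}"
    by (intro exI[of _ "e / 2"]) (auto simp del: chordal.simps)
qed

text \<open>Membership in a basin depends only on the tail of the orbit, so it passes both forwards
  and backwards along orbits.\<close>

lemma funpow_in_basin_iff: "(f ^^ n) x \<in> basin f z \<longleftrightarrow> x \<in> basin f z"
proof
  assume x: "(f ^^ n) x \<in> basin f z"
  show "x \<in> basin f z"
    unfolding basin_def
  proof (intro CollectI allI impI)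
    fix \<epsilon> :: real assume "\<epsilon> > 0"
    then obtain N where N: "\<And>k. N \<le> k \<Longrightarrow> chordal ((f ^^ k) ((f ^^ n) x)) z < \<epsilon>"
      using x unfolding basin_def by blast
    have "chordal ((f ^^ k) x) z < \<epsilon>" if "N + n \<le> k" for k
      using N[of "k - n"] that funpow_add[of "k - n" n f] by simp
    then show "\<exists>N. \<forall>k\<ge>N. chordal ((f ^^ k) x) z < \<epsilon>" by blast
  qed
next
  assume x: "x \<in> basin f z"
  show "(f ^^ n) x \<in> basin f z"
    unfolding basin_def
  proof (intro CollectI allI impI)
    fix \<epsilon> :: real assume "\<epsilon> > 0"
    then obtain N where "\<And>k. N \<le> k \<Longrightarrow> chordal ((f ^^ k) x) z < \<epsilon>"
      using x unfolding basin_def by blast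
    then show "\<exists>N. \<forall>k\<ge>N. chordal ((f ^^ k) ((f ^^ n) x)) z < \<epsilon>"
      by (metis comp_apply funpow_add trans_le_add1)
  qed
qed

lemma basin_disjoint: "x \<in> basin f (Some a) \<Longrightarrow> x \<in> basin f (Some b) \<Longrightarrow> a = b"
proof (rule ccontr)
  assume x: "x \<in> basin f (Some a)" "x \<in> basin f (Some b)" and "a \<noteq> b"
  define \<epsilon> where "\<epsilon> = chordal (Some a) (Some b) / 2"
  have "\<epsilon> > 0" using \<open>a \<noteq> b\<close> by (simp add: \<epsilon>_def one_plus_sq_pos)
  then obtain M N where "\<And>k. M \<le> k \<Longrightarrow> chordal ((f ^^ k) x) (Some a) < \<epsilon>"
      "\<And>k. N \<le> k \<Longrightarrow> chordal ((f ^^ k) x) (Some b) < \<epsilon>"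
    using x unfolding basin_def by blast
  then have "chordal ((f ^^ (M + N)) x) (Some a) < \<epsilon>" "chordal ((f ^^ (M + N)) x) (Some b) < \<epsilon>"
    by simp_all
  then show False
    using chordal_triangle[of "Some a" "Some b" "(f ^^ (M + N)) x"]
      chordal_commute[of "Some a" "(f ^^ (M + N)) x"]
    unfolding \<epsilon>_def by linarith
qed

section \<open>Rational maps as coverings\<close>

text \<open>A repeated root \<open>a\<close> gives a factorization (X - a)^2 r, which leaves at most
  1 + degree r distinct roots. The equivalence translates multiplicities in fibres into a count of
  points.\<close>

lemma card_roots_eq_degree_iff_rsquarefree:
  fixes p :: "complex poly"
  assumes "p \<noteq> 0"
  shows "card {z. poly p z = 0} = degree p \<longleftrightarrow> rsquarefree p"
proof
  assume "rsquarefree p"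
  then have "smult (lead_coeff p) (\<Prod>z|poly p z = 0. [:-z, 1:]) = p"
    by (rule complex_poly_decompose_rsquarefree)
  then have "degree p = degree (\<Prod>z|poly p z = 0. [:-z, 1:])"
    using assms by (metis degree_smult_eq leading_coeff_0_iff)
  also have "\<dots> = card {z. poly p z = 0}"
    by (subst degree_prod_sum_eq) auto
  finally show "card {z. poly p z = 0} = degree p" by simp
next
  assume card: "card {z. poly p z = 0} = degree p"
  show "rsquarefree p"
  proof (rule ccontr)
    assume "\<not> rsquarefree p"
    then obtain a where a: "poly p a = 0" "poly (pderiv p) a = 0"
      by (auto simp: rsquarefree_roots)
    then obtain q where q: "p = [:-a, 1:] * q" by (auto simp: poly_eq_0_iff_dvd)
    then have "pderiv p = [:-a, 1:] * pderiv q + q" by (simp add: pderiv_mult pderiv_pCons del: mult_pCons_left)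
    then have "poly q a = 0" using a by simp
    then obtain r where r: "q = [:-a, 1:] * r" by (auto simp: poly_eq_0_iff_dvd)
    have "r \<noteq> 0" using assms q r by auto
    have "{z. poly p z = 0} \<subseteq> insert a {z. poly r z = 0}" by (auto simp: q r)
    then have "card {z. poly p z = 0} \<le> card (insert a {z. poly r z = 0})"
      using \<open>r \<noteq> 0\<close> by (intro card_mono) (auto simp: poly_roots_finite)
    also have "\<dots> \<le> Suc (degree r)"
      using card_poly_roots_bound[OF \<open>r \<noteq> 0\<close>] \<open>r \<noteq> 0\<close>
      by (simp add: card_insert_if poly_roots_finite)
    also have "\<dots> < degree p"
      using \<open>r \<noteq> 0\<close> by (simp add: q r degree_mult_eq del: mult_pCons_left)
    finally show False using card by simp
  qed
qed

section \<open>First contact along a segment, convex neighbourhoods, and moving evaluation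
  points\<close>

lemma first_exit_segment:
  fixes w a :: complex
  assumes V: "open V" "w \<notin> V" "a \<in> V"
  obtains b where "closed_segment w b \<inter> V = {}" "b \<in> closure V"
proof -
  define \<gamma> where "\<gamma> t = w + of_real t * (a - w)" for t :: real
  have cont: "continuous_on UNIV \<gamma>" unfolding \<gamma>_def by (intro continuous_intros)
  \<comment> \<open>The infimum of \<open>A\<close> is the first contact with \<open>V\<close>. By
    openness of \<open>V\<close> it is not attained, so the end point of the segment lies outside
    \<open>V\<close> but in its closure.\<close>
  define A where "A = {t. 0 \<le> t \<and> \<gamma> t \<in> V}"
  have A: "1 \<in> A" "bdd_below A" using V by (auto simp: A_def \<gamma>_def intro!: bdd_belowI[of _ 0])
  define \<tau> where "\<tau> = Inf A"
  have \<tau>0: "0 \<le> \<tau>" 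
  proof -
    have "A \<noteq> {}" using A(1) by blast
    then show ?thesis unfolding \<tau>_def by (rule cInf_greatest) (simp add: A_def)
  qed
  have notin: "\<gamma> t \<notin> V" if "0 \<le> t" "t < \<tau>" for t
    using that cInf_lower[OF _ A(2), of t] by (auto simp: A_def \<tau>_def)
  have oV: "open (\<gamma> -` V)" using V(1) cont by (simp add: continuous_open_vimage continuous_on_eq_continuous_at)
  have \<tau>V: "\<gamma> \<tau> \<notin> V"
  proof
    assume "\<gamma> \<tau> \<in> V"
    then have "\<tau> \<noteq> 0" using V(2) by (auto simp: \<gamma>_def)
    obtain e where e: "e > 0" "\<And>t. dist t \<tau> < e \<Longrightarrow> \<gamma> t \<in> V"
      using oV \<open>\<gamma> \<tau> \<in> V\<close> unfolding open_dist by (metis vimage_eq)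
    define t where "t = max (\<tau> / 2) (\<tau> - e / 2)"
    have "0 \<le> t" "t < \<tau>" "dist t \<tau> < e"
      using \<tau>0 \<open>\<tau> \<noteq> 0\<close> e(1) by (auto simp: t_def dist_real_def)
    then show False using notin e(2) by blast
  qed
  show ?thesis
  proof (rule that[of "\<gamma> \<tau>"])
    show "closed_segment w (\<gamma> \<tau>) \<inter> V = {}"
    proof -
      have "x \<notin> V" if x: "x \<in> closed_segment w (\<gamma> \<tau>)" for x
      proof -
        obtain u where u: "0 \<le> u" "u \<le> 1" "x = (1 - u) *\<^sub>R w + u *\<^sub>R \<gamma> \<tau>"
          using x by (auto simp: in_segment)
        then have "x = \<gamma> (u * \<tau>)" by (simp add: \<gamma>_def scaleR_conv_of_real algebra_simps)
        moreover have "0 \<le> u * \<tau>" "u * \<tau> \<le> \<tau>" using u \<tau>0 by (auto simp: mult_left_le_one_le)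
        ultimately show ?thesis using notin[of "u * \<tau>"] \<tau>V by (metis order_less_le)
      qed
      then show ?thesis by blast
    qed
    show "\<gamma> \<tau> \<in> closure V"
    proof (rule ccontr)
      assume "\<gamma> \<tau> \<notin> closure V"
      then have "\<tau> \<in> \<gamma> -` (- closure V)" by simp
      moreover have "open (\<gamma> -` (- closure V))"
        using cont by (intro open_vimage) (auto simp: open_closed)
      ultimately obtain e where e: "e > 0" "\<And>t. dist t \<tau> < e \<Longrightarrow> \<gamma> t \<notin> closure V"
        unfolding open_dist by (metis vimage_eq ComplD)
      obtain t where t: "t \<in> A" "t < \<tau> + e"
        using cInf_lessD[of A "\<tau> + e"] A(1) e(1) by (auto simp: \<tau>_def)
      moreover have "\<tau> \<le> t" unfolding \<tau>_def using t(1) A(2) by (rule cInf_lower)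
      ultimately have "\<gamma> t \<notin> closure V" by (intro e(2)) (auto simp: dist_real_def)
      then show False using t(1) closure_subset[of V] by (auto simp: A_def)
    qed
  qed
qed

text \<open>The Minkowski sum of the segment with a disc of half the separating distance is convex;
  written as a union of discs it is open. Convexity is what permits lifting through a
  covering.\<close>

lemma segment_neighbourhood:
  fixes w b :: complex
  assumes "closed C" "closed_segment w b \<inter> C = {}"
  obtains D d where "convex D" "open D" "w \<in> D" "b \<in> D" "d > 0" "\<And>x y. x \<in> D \<Longrightarrow> y \<in> C \<Longrightarrow> d \<le> dist x y"
proof -
  obtain d where d: "d > 0" "\<And>x y. x \<in> closed_segment w b \<Longrightarrow> y \<in> C \<Longrightarrow> d \<le> dist x y"
    using separate_compact_closed[OF compact_segment assms] by blast
  define D where "D = (\<Union>x\<in>closed_segment w b. \<Union>y\<in>ball 0 (d / 2). {x + y})"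
  have D_eq: "D = (\<Union>x\<in>closed_segment w b. ball x (d / 2))"
  proof -
    have "(\<Union>y\<in>ball 0 (d / 2). {x + y}) = ball x (d / 2)" for x :: complex
      using ball_translation[of x 0 "d / 2"] by (auto simp: image_def)
    then show ?thesis by (simp add: D_def)
  qed
  show ?thesis
  proof (rule that[of D "d / 2"])
    show "convex D" unfolding D_def by (intro convex_sums convex_closed_segment convex_ball)
    show "open D" unfolding D_eq by auto
    show "w \<in> D" "b \<in> D" unfolding D_eq using d(1) by force+
    show "d / 2 \<le> dist x y" if "x \<in> D" "y \<in> C" for x y
    proof -
      obtain u where u: "u \<in> closed_segment w b" "dist u x < d / 2" using \<open>x \<in> D\<close> by (auto simp: D_eq)
      show ?thesis using d(2)[OF u(1) that(2)] u(2) dist_triangle[of u y x] by linarith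
    qed
  qed (use d in auto)
qed

text \<open>The inverse branches will be normalised at points of an orbit that converge to
  \<open>w\<close>, not at \<open>w\<close> itself, so the limit is taken along moving evaluation
  points.\<close>

lemma diagonal_uniform_limit:
  fixes \<phi> :: "nat \<Rightarrow> complex \<Rightarrow> complex"
  assumes "open D" "w \<in> D" "\<Phi> holomorphic_on D"
    and u: "\<And>K. compact K \<Longrightarrow> K \<subseteq> D \<Longrightarrow> uniform_limit K \<phi> \<Phi> sequentially"
    and x: "x \<longlonglongrightarrow> w"
  shows "(\<lambda>n. \<phi> n (x n)) \<longlonglongrightarrow> \<Phi> w"
proof -
  obtain \<eta> where \<eta>: "\<eta> > 0" "cball w \<eta> \<subseteq> D" using assms(1,2) open_contains_cball by blast
  have "eventually (\<lambda>n. dist (x n) w < \<eta>) sequentially" using x \<eta>(1) by (rule tendstoD)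
  then have ev: "eventually (\<lambda>n. x n \<in> cball w \<eta>) sequentially"
    by eventually_elim (simp add: dist_commute)
  have "isCont \<Phi> w"
    using holomorphic_on_imp_continuous_on[OF assms(3)] assms(1,2) continuous_on_eq_continuous_at by blast
  then have "(\<lambda>n. \<Phi> (x n)) \<longlonglongrightarrow> \<Phi> w" using x by (rule isCont_tendsto_compose)
  moreover have "(\<lambda>n. \<phi> n (x n) - \<Phi> (x n)) \<longlonglongrightarrow> 0"
  proof (rule tendstoI)
    fix e :: real assume "e > 0"
    then have "eventually (\<lambda>n. \<forall>y\<in>cball w \<eta>. dist (\<phi> n y) (\<Phi> y) < e) sequentially"
      using u[OF compact_cball \<eta>(2)] by (rule uniform_limitD[rotated])
    with ev show "eventually (\<lambda>n. dist (\<phi> n (x n) - \<Phi> (x n)) 0 < e) sequentially"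
      by eventually_elim (simp add: dist_norm)
  qed
  ultimately have "(\<lambda>n. (\<phi> n (x n) - \<Phi> (x n)) + \<Phi> (x n)) \<longlonglongrightarrow> 0 + \<Phi> w"
    by (intro tendsto_add)
  then show ?thesis by simp
qed

section \<open>Rational maps fixing infinity: fibres and critical values\<close>

locale rational_map =
  fixes P Q :: "complex poly"
  assumes degree_less: "degree Q < degree P"
    and no_common_root: "poly Q z = 0 \<Longrightarrow> poly P z \<noteq> 0"
begin

definition F :: "complex \<Rightarrow> complex" where "F z = poly P z / poly Q z"

definition sphere_map :: "sphere \<Rightarrow> sphere" where
  "sphere_map x = (case x of None \<Rightarrow> None | Some z \<Rightarrow> if poly Q z = 0 then None else Some (F z))"

definition fibre :: "complex \<Rightarrow> complex set" where
  "fibre w = {z. poly P z = w * poly Q z}"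

text \<open>Counting distinct preimages is the form needed for the covering;
  \<open>crit_vals_iff\<close> supplies the description by the derivative. Only finite critical
  values are recorded.\<close>

definition crit_vals :: "complex set" where
  "crit_vals = {w. card (fibre w) \<noteq> degree P}"

text \<open>The numerator of the derivative of \<open>F\<close>: its zeros off the poles are the
  critical points.\<close>

definition wronskian :: "complex poly" where
  "wronskian = pderiv P * Q - P * pderiv Q"

lemma sphere_map_simps [simp]:
  "sphere_map None = None"
  "poly Q z = 0 \<Longrightarrow> sphere_map (Some z) = None"
  "poly Q z \<noteq> 0 \<Longrightarrow> sphere_map (Some z) = Some (F z)"
  by (auto simp: sphere_map_def)

text \<open>If \<open>Q\<close> were zero, every point would be a zero of \<open>Q\<close>, so
  \<open>P\<close> would have no zero at all, against the fundamental theorem of algebra.\<close>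

lemma Q_nonzero: "Q \<noteq> 0"
proof
  assume "Q = 0"
  then have "\<And>z. poly P z \<noteq> 0" using no_common_root by simp
  then have "constant (poly P)" using fundamental_theorem_of_algebra by blast
  then show False using degree_less constant_degree by (metis not_less0)
qed

lemma degree_fibre: "degree (P - smult w Q) = degree P"
proof -
  have "degree (smult w Q) < degree P" using degree_less degree_smult_le le_less_trans by blast
  then show ?thesis using degree_add_eq_left[of "smult (-w) Q" P] by simp
qed

lemma fibre_eq_roots: "fibre w = {z. poly (P - smult w Q) z = 0}"
  by (auto simp: fibre_def)

lemma fibre_poly_nonzero: "P - smult w Q \<noteq> 0"
  using degree_fibre[of w] degree_less by (metis degree_0 not_less0)

lemma finite_fibre: "finite (fibre w)"
  unfolding fibre_eq_roots by (rule poly_roots_finite[OF fibre_poly_nonzero])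

lemma card_fibre_le: "card (fibre w) \<le> degree P"
  unfolding fibre_eq_roots using card_poly_roots_bound[OF fibre_poly_nonzero] degree_fibre by metis

lemma fibre_iff: "z \<in> fibre w \<longleftrightarrow> poly Q z \<noteq> 0 \<and> F z = w"
  using no_common_root[of z] by (cases "poly Q z = 0") (auto simp: fibre_def F_def field_simps)

lemma F_has_field_derivative:
  "poly Q z \<noteq> 0 \<Longrightarrow> (F has_field_derivative (poly wronskian z / (poly Q z)\<^sup>2)) (at z)"
  unfolding F_def[abs_def] wronskian_def
  by (auto intro!: derivative_eq_intros poly_DERIV simp: power2_eq_square field_simps)

lemma open_nonpoles: "open {z. poly Q z \<noteq> 0}"
  by (intro open_Collect_neq continuous_intros)

lemma F_holomorphic: "F holomorphic_on {z. poly Q z \<noteq> 0}"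
  unfolding holomorphic_on_open[OF open_nonpoles] using F_has_field_derivative by blast

text \<open>On the fibre of \<open>w\<close> one has P = w Q, and there the Wronskian equals
  \<open>Q\<close> times the derivative of P - w Q. Its zeros are therefore the multiple points of
  the fibre.\<close>

lemma crit_vals_iff: "w \<in> crit_vals \<longleftrightarrow> (\<exists>z\<in>fibre w. poly wronskian z = 0)"
proof -
  have "w \<in> crit_vals \<longleftrightarrow> \<not> rsquarefree (P - smult w Q)"
    unfolding crit_vals_def using card_roots_eq_degree_iff_rsquarefree[OF fibre_poly_nonzero[of w]]
    by (simp add: fibre_eq_roots degree_fibre)
  also have "\<dots> \<longleftrightarrow> (\<exists>z\<in>fibre w. poly (pderiv (P - smult w Q)) z = 0)"
    by (auto simp: rsquarefree_roots fibre_eq_roots)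
  also have "\<dots> \<longleftrightarrow> (\<exists>z\<in>fibre w. poly wronskian z = 0)"
  proof (rule bex_cong[OF refl])
    fix z assume "z \<in> fibre w"
    then have "poly Q z \<noteq> 0" "poly P z = w * poly Q z" by (auto simp: fibre_iff F_def)
    then have "poly wronskian z = poly Q z * poly (pderiv (P - smult w Q)) z"
      by (simp add: wronskian_def pderiv_diff pderiv_smult algebra_simps)
    then show "poly (pderiv (P - smult w Q)) z = 0 \<longleftrightarrow> poly wronskian z = 0"
      using \<open>poly Q z \<noteq> 0\<close> by simp
  qed
  finally show ?thesis .
qed

lemma crit_vals_subset: "crit_vals \<subseteq> F ` {z. poly wronskian z = 0 \<and> poly Q z \<noteq> 0}"
  by (auto simp: crit_vals_iff fibre_iff)

text \<open>The coefficient at degree P - 1 + degree Q is the difference of the degrees times both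
  leading coefficients, and the degrees differ.\<close>

lemma wronskian_nonzero: "wronskian \<noteq> 0"
proof
  assume W: "wronskian = 0"
  have 1: "coeff (pderiv P * Q) (degree P - 1 + degree Q) = of_nat (degree P) * lead_coeff P * lead_coeff Q"
    using coeff_mult_degree_sum[of "pderiv P" Q] degree_less by (simp add: degree_pderiv coeff_pderiv)
  have 2: "coeff (P * pderiv Q) (degree P - 1 + degree Q) = of_nat (degree Q) * lead_coeff P * lead_coeff Q"
  \<comment> \<open>A constant \<open>Q\<close> is treated apart: its derivative is zero, and degree
    Q - 1 would be truncated.\<close>
  proof (cases "degree Q = 0")
    case True
    then have "pderiv Q = 0" by (simp add: pderiv_eq_0_iff)
    then show ?thesis using True by simp
  next
    case False
    then have "degree P - 1 + degree Q = degree P + degree (pderiv Q)"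
      using degree_less by (simp add: degree_pderiv)
    then show ?thesis
      using coeff_mult_degree_sum[of P "pderiv Q"] False by (simp add: degree_pderiv coeff_pderiv)
  qed
  have "of_nat (degree P) * lead_coeff P * lead_coeff Q = of_nat (degree Q) * lead_coeff P * lead_coeff Q"
    using W 1 2 by (simp add: wronskian_def)
  then show False using degree_less Q_nonzero by auto
qed

lemma degree_wronskian_le: "degree wronskian \<le> degree P + degree Q - 1"
proof -
  have "degree (pderiv P * Q) \<le> degree P + degree Q - 1"
    using degree_mult_le[of "pderiv P" Q] degree_less by (simp add: degree_pderiv)
  moreover have "degree (P * pderiv Q) \<le> degree P + degree Q - 1"
  proof (cases "degree Q = 0")
    case True
    then have "pderiv Q = 0" by (simp add: pderiv_eq_0_iff)
    then show ?thesis by simp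
  next
    case False
    then show ?thesis using degree_mult_le[of P "pderiv Q"] by (simp add: degree_pderiv)
  qed
  ultimately show ?thesis unfolding wronskian_def by (rule degree_diff_le)
qed

lemma finite_crit_vals: "finite crit_vals"
  by (rule finite_subset[OF crit_vals_subset]) (simp add: poly_roots_finite wronskian_nonzero)

text \<open>Every critical value is the image of a zero of the Wronskian, whose degree bounds the
  number of its zeros.\<close>

lemma card_crit_vals_le: "card crit_vals \<le> degree P + degree Q - 1"
proof -
  have "card crit_vals \<le> card (F ` {z. poly wronskian z = 0})"
    using crit_vals_subset by (intro card_mono) (auto simp: poly_roots_finite wronskian_nonzero)
  also have "\<dots> \<le> card {z. poly wronskian z = 0}"
    by (rule card_image_le) (simp add: poly_roots_finite wronskian_nonzero)
  also have "\<dots> \<le> degree wronskian" by (rule card_poly_roots_bound[OF wronskian_nonzero])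
  finally show ?thesis using degree_wronskian_le by linarith
qed

section \<open>The covering and inverse branches of iterates\<close>

definition cover :: "complex set" where
  "cover = {z. poly Q z \<noteq> 0 \<and> F z \<notin> crit_vals}"

lemma open_cover: "open cover"
proof -
  have "open ({z. poly Q z \<noteq> 0} \<inter> F -` (- crit_vals))"
    using F_holomorphic open_nonpoles finite_crit_vals
    by (intro continuous_open_preimage holomorphic_on_imp_continuous_on)
       (auto simp: finite_imp_closed)
  moreover have "cover = {z. poly Q z \<noteq> 0} \<inter> F -` (- crit_vals)" by (auto simp: cover_def)
  ultimately show ?thesis by simp
qed

lemma F_holomorphic_cover: "F holomorphic_on cover"
  by (rule holomorphic_on_subset[OF F_holomorphic]) (auto simp: cover_def)

text \<open>Over a small neighbourhood of a non-critical value the local inverses already account for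
  \<open>degree P\<close> points of each fibre, and a fibre has no more points than that.\<close>

lemma covering_space_F: "covering_space cover F (- crit_vals)"
proof
  show "continuous_on cover F"
    by (rule holomorphic_on_imp_continuous_on[OF F_holomorphic_cover])
  show "F ` cover = - crit_vals"
  proof (intro subset_antisym subsetI)
    fix w assume w: "w \<in> - crit_vals"
    then have "card (fibre w) > 0" using degree_less by (simp add: crit_vals_def)
    then obtain z where "z \<in> fibre w" by (metis card_gt_0_iff ex_in_conv)
    then show "w \<in> F ` cover" using w by (auto simp: fibre_iff cover_def)
  qed (auto simp: cover_def)
  fix w assume w: "w \<in> - crit_vals"
  have inj: "\<exists>r>0. ball z r \<subseteq> {z. poly Q z \<noteq> 0} \<and> inj_on F (ball z r)" if "z \<in> fibre w" for z
  proof -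
    have z: "poly Q z \<noteq> 0" "poly wronskian z \<noteq> 0"
      using that w by (auto simp: crit_vals_iff fibre_iff)
    have "deriv F z \<noteq> 0"
      using z by (simp add: DERIV_imp_deriv[OF F_has_field_derivative])
    then show ?thesis
      using has_complex_derivative_locally_invertible[OF F_holomorphic _ open_nonpoles, of z] z by blast
  qed
  then obtain r where r: "\<And>z. z \<in> fibre w \<Longrightarrow> r z > 0"
      "\<And>z. z \<in> fibre w \<Longrightarrow> ball z (r z) \<subseteq> {z. poly Q z \<noteq> 0}"
      "\<And>z. z \<in> fibre w \<Longrightarrow> inj_on F (ball z (r z))"
    by metis
  have sep: "\<exists>d>0. \<forall>z'\<in>fibre w. z' \<noteq> z \<longrightarrow> d \<le> dist z z'" for z
    using finite_set_avoid[OF finite_fibre] by blast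
  then obtain d where d: "\<And>z. d z > 0" "\<And>z z'. z' \<in> fibre w \<Longrightarrow> z' \<noteq> z \<Longrightarrow> d z \<le> dist z z'"
    by metis
  \<comment> \<open>One radius for all points of the fibre: \<open>F\<close> is injective on each
    disc, and half the separation makes the discs disjoint.\<close>
  define \<delta> where "\<delta> = Min (insert 1 ((\<lambda>z. min (r z) (d z / 2)) ` fibre w))"
  have "\<delta> \<le> min (r z) (d z / 2)" if "z \<in> fibre w" for z
    unfolding \<delta>_def using finite_fibre[of w] that by (intro Min_le) auto
  moreover have "\<delta> > 0"
    unfolding \<delta>_def using finite_fibre[of w] r(1) d(1) by (auto simp: Min_gr_iff)
  ultimately have \<delta>: "\<delta> > 0" "\<And>z. z \<in> fibre w \<Longrightarrow> \<delta> \<le> r z" "\<And>z. z \<in> fibre w \<Longrightarrow> \<delta> \<le> d z / 2"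
    by auto
  have disj: "ball z \<delta> \<inter> ball z' \<delta> = {}" if "z \<in> fibre w" "z' \<in> fibre w" "z \<noteq> z'" for z z'
    using d(2)[of z' z] \<delta>(3)[of z] that by (intro disjoint_ballI) auto
  have sub: "ball z \<delta> \<subseteq> {z. poly Q z \<noteq> 0}" "inj_on F (ball z \<delta>)" if "z \<in> fibre w" for z
    using r(2,3)[OF that] subset_ball[OF \<delta>(2)[OF that]] by (blast intro: inj_on_subset)+
  define T where "T = (\<Inter>z\<in>fibre w. F ` ball z \<delta>) - crit_vals"
  have wT: "w \<in> T"
    using w \<delta>(1) by (force simp: T_def fibre_iff)
  have openim: "open (F ` ball z \<delta>)" if "z \<in> fibre w" for z
    by (rule open_mapping_thm3[OF holomorphic_on_subset[OF F_holomorphic sub(1)[OF that]] open_ball sub(2)[OF that]])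
  have openT: "open T"
    unfolding T_def using openim finite_fibre finite_crit_vals
    by (intro open_Diff open_INT) (auto simp: finite_imp_closed)
  define u where "u z = ball z \<delta> \<inter> (cover \<inter> F -` T)" for z
  have openu: "open (u z)" for z
    unfolding u_def
    using openT F_holomorphic_cover open_cover
    by (intro open_Int continuous_open_preimage holomorphic_on_imp_continuous_on) auto
  have un: "\<Union> (u ` fibre w) = cover \<inter> F -` T"
  proof (intro subset_antisym subsetI)
    fix y assume y: "y \<in> cover \<inter> F -` T"
    have "\<exists>x\<in>ball z \<delta>. F x = F y" if "z \<in> fibre w" for z
      using y that by (fastforce simp: T_def)
    then obtain x where x: "\<And>z. z \<in> fibre w \<Longrightarrow> x z \<in> ball z \<delta>"
        "\<And>z. z \<in> fibre w \<Longrightarrow> F (x z) = F y" by metis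
    have "inj_on x (fibre w)"
      using x(1) disj by (intro inj_onI) (metis disjoint_iff)
    then have "card (x ` fibre w) = degree P"
      using w by (simp add: card_image crit_vals_def)
    moreover have "x ` fibre w \<subseteq> fibre (F y)"
    proof
      fix t assume "t \<in> x ` fibre w"
      then obtain z where z: "z \<in> fibre w" "t = x z" by blast
      then have "poly Q t \<noteq> 0" using x(1) sub(1) by blast
      then show "t \<in> fibre (F y)" using x(2) z by (simp add: fibre_iff)
    qed
    ultimately have "x ` fibre w = fibre (F y)"
      using card_fibre_le[of "F y"] by (intro card_seteq finite_fibre) auto
    moreover have "y \<in> fibre (F y)" using y by (auto simp: fibre_iff cover_def)
    ultimately obtain z where "z \<in> fibre w" "y = x z" by blast
    then show "y \<in> \<Union> (u ` fibre w)" using x(1) y by (auto simp: u_def)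
  qed (auto simp: u_def)
  have hom: "\<exists>q. homeomorphism (u z) T F q" if z: "z \<in> fibre w" for z
  proof -
    have hol: "F holomorphic_on ball z \<delta>"
      by (rule holomorphic_on_subset[OF F_holomorphic sub(1)[OF z]])
    obtain g where g: "g holomorphic_on (F ` ball z \<delta>)" "\<And>x. x \<in> ball z \<delta> \<Longrightarrow> g (F x) = x"
      by (rule holomorphic_has_inverse[OF hol open_ball sub(2)[OF z]]) (rule that)
    have TI: "T \<subseteq> F ` ball z \<delta>" using z by (auto simp: T_def)
    have Fu: "F ` u z = T"
    proof (intro subset_antisym subsetI)
      fix t assume t: "t \<in> T"
      then obtain x where x: "x \<in> ball z \<delta>" "t = F x" using TI by blast
      then have "x \<in> cover" using t sub(1)[OF z] by (auto simp: cover_def T_def)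
      then show "t \<in> F ` u z" using x t by (auto simp: u_def)
    qed (auto simp: u_def)
    have "homeomorphism (u z) T F g"
      unfolding homeomorphism_def
    proof (intro conjI ballI)
      show "continuous_on (u z) F"
        by (rule continuous_on_subset[OF holomorphic_on_imp_continuous_on[OF hol]]) (auto simp: u_def)
      show "continuous_on T g"
        by (rule continuous_on_subset[OF holomorphic_on_imp_continuous_on[OF g(1)] TI])
      show "F ` u z = T" by (rule Fu)
      show gu: "g (F x) = x" if "x \<in> u z" for x using that g(2) by (auto simp: u_def)
      show "g ` T = u z" using gu unfolding Fu[symmetric] by force
      show "F (g y) = y" if "y \<in> T" for y using that gu unfolding Fu[symmetric] by force
    qed
    then show ?thesis by blast
  qed
  show "\<exists>T. w \<in> T \<and> openin (top_of_set (- crit_vals)) T \<and>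
          (\<exists>v. \<Union> v = cover \<inter> F -` T \<and> (\<forall>u\<in>v. openin (top_of_set cover) u) \<and>
               pairwise disjnt v \<and> (\<forall>u\<in>v. \<exists>q. homeomorphism u T F q))"
  proof (intro exI[of _ T] exI[of _ "u ` fibre w"] conjI)
    show "openin (top_of_set (- crit_vals)) T"
      using openT by (intro open_openin_trans) (auto simp: T_def finite_crit_vals finite_imp_closed open_closed)
    show "\<forall>u\<in>u ` fibre w. openin (top_of_set cover) u"
      using openu open_cover by (auto simp: u_def intro!: open_openin_trans)
    show "pairwise disjnt (u ` fibre w)"
      using disj by (fastforce simp: pairwise_def disjnt_def u_def)
  qed (use wT un hom in auto)
qed

text \<open>A convex set is simply connected, so \<open>g\<close> lifts through the covering with a
  prescribed value at \<open>w\<close>; a lift of a holomorphic map through a holomorphic covering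
  is holomorphic.\<close>

lemma lift_through_F:
  assumes D: "convex D" and g: "g holomorphic_on D" "g ` D \<inter> crit_vals = {}"
    and w: "w \<in> D" "poly Q a \<noteq> 0" "F a = g w"
  obtains k where "k holomorphic_on D" "k w = a" "\<And>y. y \<in> D \<Longrightarrow> poly Q (k y) \<noteq> 0 \<and> F (k y) = g y"
proof -
  have gD: "g \<in> D \<rightarrow> - crit_vals" using g(2) by auto
  have "a \<in> cover" using w g(2) by (auto simp: cover_def)
  from covering_space_lift_strong[OF covering_space_F this w(1) convex_imp_simply_connected[OF D]
     convex_imp_locally_path_connected[OF D] holomorphic_on_imp_continuous_on[OF g(1)] gD w(3)[symmetric]]
  obtain k where k: "continuous_on D k" "k \<in> D \<rightarrow> cover" "k w = a" "\<And>y. y \<in> D \<Longrightarrow> F (k y) = g y"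
    by blast
  have "k holomorphic_on D"
    by (rule covering_space_lift_is_holomorphic[OF covering_space_F open_cover F_holomorphic_cover
          g(1) gD k(2,1)]) (use k in auto)
  then show ?thesis using that k by (force simp: cover_def)
qed

text \<open>The postcritical set, which contains the critical values themselves by
  \<open>k = 0\<close>. Only the finite points of the orbits are recorded.\<close>

definition post_crit :: "complex set" where
  "post_crit = {y. \<exists>k. \<exists>v\<in>crit_vals. (sphere_map ^^ k) (Some v) = Some y}"

lemma funpow_None [simp]: "(sphere_map ^^ k) None = None"
  by (induction k) auto

text \<open>Induction on the number of steps, splitting off the first one: a branch \<open>g\<close>
  for the remaining \<open>n\<close> steps with \<open>g w = F z\<close> is lifted once more through
  \<open>F\<close>.\<close>

lemma inverse_branch:
  assumes D: "convex D" "D \<inter> post_crit = {}"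
    and w: "w \<in> D" "(sphere_map ^^ n) (Some z) = Some w"
  obtains g where "g holomorphic_on D" "g w = z" "\<And>y. y \<in> D \<Longrightarrow> (sphere_map ^^ n) (Some (g y)) = Some y"
  using w(2)
proof (induction n arbitrary: z thesis)
  case 0
  then show ?case by (intro 0(1)[of "\<lambda>x. x"]) auto
next
  case (Suc n)
  have z: "poly Q z \<noteq> 0"
    using Suc.prems(2) by (auto simp: funpow_Suc_right simp del: funpow.simps)
  then have "(sphere_map ^^ n) (Some (F z)) = Some w"
    using Suc.prems(2) by (simp add: funpow_Suc_right del: funpow.simps)
  then obtain g where g: "g holomorphic_on D" "g w = F z"
      "\<And>y. y \<in> D \<Longrightarrow> (sphere_map ^^ n) (Some (g y)) = Some y"
    using Suc.IH by blast
  \<comment> \<open>A critical value among the values of \<open>g\<close> would reach a point of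
    \<open>D\<close> after \<open>n\<close> steps and make that point postcritical.\<close>
  have "g ` D \<inter> crit_vals = {}"
    using g(3) D(2) by (fastforce simp: post_crit_def)
  then obtain k where k: "k holomorphic_on D" "k w = z" "\<And>y. y \<in> D \<Longrightarrow> poly Q (k y) \<noteq> 0 \<and> F (k y) = g y"
    using lift_through_F[OF D(1) g(1) _ w(1) z] g(2) by metis
  then show ?case
    by (intro Suc.prems(1)[of k]) (use g(3) in \<open>auto simp: funpow_Suc_right simp del: funpow.simps\<close>)
qed

end

section \<open>Basins and the Fatou set\<close>

text \<open>\<open>up < 1\<close> says that points near infinity move inwards; the lower bound with
  \<open>lo\<close> gives continuity at infinity. \<open>another_in_Z\<close> gives \<open>Z\<close>
  at least two elements, so for each there is another one whose trap inverse branches can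
  omit.\<close>

locale attracting_rational_map = rational_map +
  fixes Z :: "complex set" and R lo up :: real
  assumes infinity_const: "0 < R" "0 < lo" "0 \<le> up" "up < 1"
    and infinity_repelling:
      "R \<le> cmod z \<Longrightarrow> poly Q z \<noteq> 0 \<and> lo * cmod z \<le> cmod (F z) \<and> cmod (F z) \<le> up * cmod z"
    and finite_Z: "finite Z"
    and another_in_Z: "\<exists>b\<in>Z. b \<noteq> a"
    and fixed: "a \<in> Z \<Longrightarrow> poly Q a \<noteq> 0 \<and> F a = a"
    and attracting: "a \<in> Z \<Longrightarrow> cmod (deriv F a) < 1"
begin

abbreviation "f \<equiv> sphere_map"

lemma F_isCont: "poly Q z \<noteq> 0 \<Longrightarrow> isCont F z"
  using F_has_field_derivative DERIV_isCont by blast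

lemma eventually_nonpole: "poly Q z \<noteq> 0 \<Longrightarrow> eventually (\<lambda>w. poly Q w \<noteq> 0) (nhds z)"
  using eventually_nhds_in_open[OF open_nonpoles, of z] by simp

lemma sphere_cont_sphere_map: "sphere_cont f"
  unfolding sphere_cont_def
proof (intro allI impI)
  fix x and \<epsilon> :: real assume \<epsilon>: "\<epsilon> > 0"
  show "\<exists>\<delta>>0. \<forall>y. chordal x y < \<delta> \<longrightarrow> chordal (f x) (f y) < \<epsilon>"
  proof (cases x)
    case None
    \<comment> \<open>Beyond \<open>M\<close> the lower bound \<open>lo * cmod w\<close> exceeds 2 /
      \<epsilon>, and then the image is within chordal distance \<epsilon> of infinity.\<close>
    define M where "M = max R (2 / (lo * \<epsilon>))"
    have "M > 0" using infinity_const by (simp add: M_def)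
    then obtain \<delta> where \<delta>: "\<delta> > 0" "\<And>w. chordal None (Some w) < \<delta> \<Longrightarrow> M < cmod w"
      using chordal_None_less_imp by blast
    have "chordal (f None) (f y) < \<epsilon>" if "chordal None y < \<delta>" for y
    proof (cases y)
      case (Some w)
      then have w: "R \<le> cmod w" "2 / (lo * \<epsilon>) < cmod w"
        using \<delta>(2)[of w] that by (auto simp: M_def simp del: chordal.simps)
      have lt: "2 / \<epsilon> < cmod (F w)"
      proof -
        have "2 / \<epsilon> < lo * cmod w" using w(2) infinity_const \<epsilon> by (simp add: field_simps)
        then show ?thesis using infinity_repelling[OF w(1)] by linarith
      qed
      have "0 < 2 / \<epsilon>" using \<epsilon> by simp
      then have pos: "0 < cmod (F w)" using lt by linarith
      have "chordal None (Some (F w)) \<le> 2 / cmod (F w)" using pos by (intro chordal_None_le) auto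
      also have "\<dots> < \<epsilon>" using lt pos \<epsilon> by (simp add: field_simps)
      finally show ?thesis using Some infinity_repelling[OF w(1)] by simp
    qed (use \<epsilon> in simp)
    then show ?thesis using \<delta>(1) None by blast
  next
    case (Some z)
    have "eventually (\<lambda>w. chordal (f (Some z)) (f (Some w)) < \<epsilon>) (nhds z)"
    proof (cases "poly Q z = 0")
      case False
      have "eventually (\<lambda>w. dist (F w) (F z) < \<epsilon> / 2) (nhds z)"
        using F_isCont[OF False] \<epsilon> by (intro tendstoD) (auto simp: continuous_at tendsto_at_iff_tendsto_nhds)
      then show ?thesis using eventually_nonpole[OF False]
      proof eventually_elim
        case (elim w)
        then show ?case
          using chordal_le_dist[of "F z" "F w"] False by (simp add: dist_commute del: chordal.simps)
      qed
    next
      case True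
      \<comment> \<open>At a pole the reciprocal is continuous because \<open>P\<close> does not
        vanish there, and twice its modulus bounds the chordal distance of \<open>F w\<close> to
        infinity.\<close>
      define G where "G w = poly Q w / poly P w" for w
      have P: "poly P z \<noteq> 0" using no_common_root[OF True] .
      have "isCont G z" unfolding G_def[abs_def] using P by (intro continuous_intros) auto
      then have "eventually (\<lambda>w. dist (G w) (G z) < \<epsilon> / 2) (nhds z)"
        using \<epsilon> by (intro tendstoD) (auto simp: continuous_at tendsto_at_iff_tendsto_nhds)
      moreover have "eventually (\<lambda>w. poly P w \<noteq> 0) (nhds z)"
        using P by (intro eventually_nhds_in_open[of "{w. poly P w \<noteq> 0}", simplified])
          (auto intro!: open_Collect_neq continuous_intros)
      ultimately show ?thesis
      proof eventually_elim
        case (elim w)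
        show ?case
        proof (cases "poly Q w = 0")
          case False
          then have "chordal None (Some (F w)) \<le> 2 / cmod (F w)"
            using elim by (intro chordal_None_le) (simp add: F_def)
          also have "\<dots> = 2 * cmod (G w)" by (simp add: F_def G_def norm_divide)
          also have "\<dots> < \<epsilon>" using elim True by (simp add: G_def)
          finally show ?thesis using False True by (simp del: chordal.simps)
        qed (use True \<epsilon> in simp)
      qed
    qed
    from eventually_nhds_imp_chordal[OF this] show ?thesis using Some by simp
  qed
qed

lemma funpow_cont:
  assumes "\<epsilon> > 0"
  obtains \<delta> where "\<delta> > 0" "\<And>y. chordal x y < \<delta> \<Longrightarrow> chordal ((f ^^ k) x) ((f ^^ k) y) < \<epsilon>"
  using sphere_cont_funpow[OF sphere_cont_sphere_map, of k] assms unfolding sphere_cont_def by blast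

section \<open>Trapping discs around attracting fixed points, and basins as part of the Fatou
  set\<close>

definition trap :: "complex \<Rightarrow> real \<Rightarrow> real \<Rightarrow> bool" where
  "trap a r \<kappa> \<longleftrightarrow> 0 < r \<and> 0 \<le> \<kappa> \<and> \<kappa> < 1 \<and>
     (\<forall>z. dist z a < r \<longrightarrow> poly Q z \<noteq> 0 \<and> dist (F z) a \<le> \<kappa> * dist z a)"

text \<open>The contraction is towards the centre, so every smaller disc is again a trap; radii can
  thus be adapted to each situation.\<close>

lemma trap_mono: "trap a r \<kappa> \<Longrightarrow> 0 < r' \<Longrightarrow> r' \<le> r \<Longrightarrow> trap a r' \<kappa>"
  unfolding trap_def by force

lemma trapD:
  assumes "trap a r \<kappa>"
  shows "0 < r" "0 \<le> \<kappa>" "\<kappa> < 1"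
  using assms by (simp_all add: trap_def)

text \<open>The difference quotients at \<open>a\<close> converge to a derivative of modulus below
  1, hence stay below some \<open>\<kappa> < 1\<close> on a disc.\<close>

lemma trap_exists:
  assumes "a \<in> Z"
  obtains r \<kappa> where "trap a r \<kappa>"
proof -
  have a: "poly Q a \<noteq> 0" "F a = a" using fixed[OF assms] by auto
  obtain \<kappa> where \<kappa>: "cmod (deriv F a) < \<kappa>" "\<kappa> < 1" using attracting[OF assms] dense by blast
  have "(F has_field_derivative deriv F a) (at a)"
    using F_has_field_derivative[OF a(1)] DERIV_imp_deriv by metis
  then have "((\<lambda>z. (F z - F a) / (z - a)) \<longlongrightarrow> deriv F a) (at a)"
    by (simp add: has_field_derivative_iff)
  then have "((\<lambda>z. cmod ((F z - F a) / (z - a))) \<longlongrightarrow> cmod (deriv F a)) (at a)"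
    by (rule tendsto_norm)
  then have "eventually (\<lambda>z. cmod ((F z - F a) / (z - a)) < \<kappa>) (at a)"
    using \<kappa>(1) by (rule order_tendstoD)
  then have "eventually (\<lambda>z. poly Q z \<noteq> 0 \<and> (z \<noteq> a \<longrightarrow> cmod ((F z - F a) / (z - a)) < \<kappa>)) (nhds a)"
    using eventually_nonpole[OF a(1)] by (auto simp: eventually_at_filter elim: eventually_elim2)
  then obtain r where r: "r > 0"
      "\<And>z. dist z a < r \<Longrightarrow> poly Q z \<noteq> 0 \<and> (z \<noteq> a \<longrightarrow> cmod ((F z - F a) / (z - a)) < \<kappa>)"
    by (auto simp: eventually_nhds_metric)
  have "dist (F z) a \<le> \<kappa> * dist z a" if "dist z a < r" for z
  proof (cases "z = a")
    case False
    then have "cmod (F z - a) / cmod (z - a) < \<kappa>"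
      using r(2)[OF that] a by (simp add: norm_divide)
    then show ?thesis using False by (simp add: dist_norm field_simps)
  qed (simp add: a)
  then have "trap a r \<kappa>"
    unfolding trap_def using r \<kappa> norm_ge_zero[of "deriv F a"] by (smt (verit))
  then show ?thesis by (rule that)
qed

lemma trap_funpow:
  assumes "trap a r \<kappa>" "dist z a < r"
  shows "\<exists>y. (f ^^ k) (Some z) = Some y \<and> dist y a \<le> \<kappa> ^ k * dist z a \<and> dist y a < r"
proof (induction k)
  case (Suc k)
  then obtain y where y: "(f ^^ k) (Some z) = Some y" "dist y a \<le> \<kappa> ^ k * dist z a" "dist y a < r"
    by blast
  have \<kappa>: "0 \<le> \<kappa>" "\<kappa> < 1" using assms by (auto simp: trap_def)
  have F: "poly Q y \<noteq> 0" "dist (F y) a \<le> \<kappa> * dist y a" using assms(1) y(3) by (auto simp: trap_def)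
  have "\<kappa> * dist y a \<le> \<kappa> * (\<kappa> ^ k * dist z a)" using \<kappa> y by (intro mult_left_mono) auto
  moreover have "\<kappa> * dist y a \<le> 1 * dist y a" using \<kappa> by (intro mult_right_mono) auto
  ultimately show ?case using F y by (auto simp: mult_ac)
qed (use assms in auto)

text \<open>The geometric bound \<open>\<kappa> ^ j * r\<close> does not depend on \<open>y\<close>,
  and this uniformity is what normality needs. The factor 2 compares \<open>chordal\<close> with
  \<open>dist\<close>.\<close>

lemma trap_uniform:
  assumes "trap a r \<kappa>" "\<epsilon> > 0"
  obtains N where "\<And>j y. N \<le> j \<Longrightarrow> dist y a < r \<Longrightarrow> chordal ((f ^^ j) (Some y)) (Some a) < \<epsilon>"
proof -
  have \<kappa>: "0 \<le> \<kappa>" "\<kappa> < 1" "0 < r" using assms by (auto simp: trap_def)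
  have "(\<lambda>n. 2 * (\<kappa> ^ n * r)) \<longlonglongrightarrow> 2 * (0 * r)"
    using \<kappa> by (intro tendsto_intros LIMSEQ_realpow_zero)
  then have "eventually (\<lambda>n. 2 * (\<kappa> ^ n * r) < \<epsilon>) sequentially"
    using assms(2) by (intro order_tendstoD(2)[where a = \<epsilon>]) auto
  then obtain N where N: "\<And>n. N \<le> n \<Longrightarrow> 2 * (\<kappa> ^ n * r) < \<epsilon>"
    by (auto simp: eventually_sequentially)
  show ?thesis
  proof (rule that)
    fix j y assume "N \<le> j" "dist y a < r"
    then obtain x where x: "(f ^^ j) (Some y) = Some x" "dist x a \<le> \<kappa> ^ j * dist y a"
      using trap_funpow[OF assms(1)] by blast
    have "\<kappa> ^ j * dist y a \<le> \<kappa> ^ j * r" using \<open>dist y a < r\<close> \<kappa> by (intro mult_left_mono) auto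
    then show "chordal ((f ^^ j) (Some y)) (Some a) < \<epsilon>"
      using x chordal_le_dist[of x a] N[OF \<open>N \<le> j\<close>] by (simp del: chordal.simps)
  qed
qed

text \<open>Entering a trap once already forces convergence, so a limit condition becomes a
  condition on one iterate, for any trap about \<open>a\<close>.\<close>

lemma basin_iff:
  assumes "trap a r \<kappa>"
  shows "x \<in> basin f (Some a) \<longleftrightarrow> (\<exists>k y. (f ^^ k) x = Some y \<and> dist y a < r)"
proof
  assume x: "x \<in> basin f (Some a)"
  have "r > 0" using assms by (simp add: trap_def)
  then obtain e where e: "e > 0" "\<And>x. chordal (Some a) x < e \<Longrightarrow> \<exists>w. x = Some w \<and> dist a w < r"
    using chordal_Some_less_imp[of r a] by blast
  obtain N where "chordal ((f ^^ N) x) (Some a) < e" using x e(1) unfolding basin_def by blast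
  then show "\<exists>k y. (f ^^ k) x = Some y \<and> dist y a < r"
    using e(2) by (metis chordal_commute dist_commute)
next
  assume "\<exists>k y. (f ^^ k) x = Some y \<and> dist y a < r"
  then obtain k y where y: "(f ^^ k) x = Some y" "dist y a < r" by blast
  show "x \<in> basin f (Some a)"
    unfolding basin_def
  proof (intro CollectI allI impI)
    fix \<epsilon> :: real assume "\<epsilon> > 0"
    obtain N where N: "\<And>j y. N \<le> j \<Longrightarrow> dist y a < r \<Longrightarrow> chordal ((f ^^ j) (Some y)) (Some a) < \<epsilon>"
      using trap_uniform[OF assms \<open>\<epsilon> > 0\<close>] by blast
    have "chordal ((f ^^ j) x) (Some a) < \<epsilon>" if "N + k \<le> j" for j
    proof -
      have "(f ^^ j) x = (f ^^ (j - k)) (Some y)"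
        using that y(1) funpow_add[of "j - k" k f] by simp
      then show ?thesis using N[of "j - k" y] that y(2) by simp
    qed
    then show "\<exists>N. \<forall>k\<ge>N. chordal ((f ^^ k) x) (Some a) < \<epsilon>" by blast
  qed
qed

definition basins :: "sphere set" where "basins = (\<Union>a\<in>Z. basin f (Some a))"

lemma funpow_in_basins_iff: "(f ^^ n) x \<in> basins \<longleftrightarrow> x \<in> basins"
  by (simp add: basins_def funpow_in_basin_iff)

lemma fixed_in_basin: "a \<in> Z \<Longrightarrow> Some a \<in> basin f (Some a)"
proof -
  assume "a \<in> Z"
  then obtain r \<kappa> where t: "trap a r \<kappa>" by (rule trap_exists)
  then show ?thesis
    unfolding basin_iff[OF t] by (intro exI[of _ "0::nat"] exI[of _ a]) (auto simp: trap_def)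
qed

lemma sph_open_trapped:
  "sph_open {x. \<exists>y. (f ^^ k) x = Some y \<and> dist y a < r}"
  unfolding sph_open_def
proof (intro ballI)
  fix x assume "x \<in> {x. \<exists>y. (f ^^ k) x = Some y \<and> dist y a < r}"
  then obtain y where y: "(f ^^ k) x = Some y" "dist y a < r" by blast
  obtain e where e: "e > 0" "\<And>x. chordal (Some y) x < e \<Longrightarrow> \<exists>w. x = Some w \<and> dist y w < r - dist y a"
    using chordal_Some_less_imp[of "r - dist y a" y] y(2) by auto
  obtain \<delta> where \<delta>: "\<delta> > 0" "\<And>x'. chordal x x' < \<delta> \<Longrightarrow> chordal ((f ^^ k) x) ((f ^^ k) x') < e"
    using funpow_cont[OF e(1)] by blast
  have "\<exists>y'. (f ^^ k) x' = Some y' \<and> dist y' a < r" if x': "chordal x x' < \<delta>" for x'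
  proof -
    obtain w where "(f ^^ k) x' = Some w" "dist y w < r - dist y a"
      using e(2) \<delta>(2)[OF x'] y(1) by auto
    then show ?thesis using dist_triangle[of w a y] by (auto simp: dist_commute)
  qed
  then show "\<exists>e>0. \<forall>x'. chordal x x' < e \<longrightarrow> x' \<in> {x. \<exists>y. (f ^^ k) x = Some y \<and> dist y a < r}"
    using \<delta>(1) by blast
qed

lemma open_basin:
  assumes "a \<in> Z"
  shows "open {z. Some z \<in> basin f (Some a)}"
proof -
  obtain r \<kappa> where t: "trap a r \<kappa>" using trap_exists[OF assms] .
  have "{z. Some z \<in> basin f (Some a)} = (\<Union>k. {z. Some z \<in> {x. \<exists>y. (f ^^ k) x = Some y \<and> dist y a < r}})"
    by (auto simp: basin_iff[OF t])
  then show ?thesis using open_if_sph_open[OF sph_open_trapped] by auto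
qed

lemma open_basins: "open {z. Some z \<in> basins}"
proof -
  have "{z. Some z \<in> basins} = (\<Union>a\<in>Z. {z. Some z \<in> basin f (Some a)})"
    by (auto simp: basins_def)
  then show ?thesis using open_basin by auto
qed

lemma basin_subset_fatou:
  assumes "a \<in> Z"
  shows "basin f (Some a) \<subseteq> fatou_set f"
proof
  fix x assume x: "x \<in> basin f (Some a)"
  obtain r \<kappa> where t: "trap a r \<kappa>" using trap_exists[OF assms] .
  obtain k y where y: "(f ^^ k) x = Some y" "dist y a < r" using x basin_iff[OF t] by blast
  define U where "U = {x. \<exists>y. (f ^^ k) x = Some y \<and> dist y a < r}"
  have "normal_family (range (\<lambda>k. f ^^ k)) U"
    unfolding normal_family_def
  proof (intro allI impI)
    fix s :: "nat \<Rightarrow> sphere \<Rightarrow> sphere" assume "\<forall>n. s n \<in> range (\<lambda>k. f ^^ k)"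
    then have "\<forall>n. \<exists>m. s n = f ^^ m" by blast
    then obtain m where m: "\<And>n. s n = f ^^ m n" by metis
    show "\<exists>r g. strict_mono r \<and> locunif_conv (s \<circ> r) g U"
    \<comment> \<open>Either some exponent recurs infinitely often, and a subsequence is constant,
      or the exponents tend to infinity, and the iterates converge to \<open>a\<close> uniformly on
      \<open>U\<close>.\<close>
    proof (cases "\<exists>c. infinite {n. m n = c}")
      case True
      then obtain c where c: "infinite {n. m n = c}" by blast
      have "strict_mono (enumerate {n. m n = c})" using c by (rule strict_mono_enumerate)
      moreover have "(s \<circ> enumerate {n. m n = c}) n = f ^^ c" for n
        using enumerate_in_set[OF c, of n] m by simp
      then have "locunif_conv (s \<circ> enumerate {n. m n = c}) (f ^^ c) U"
        unfolding locunif_conv_def by (auto intro!: exI[of _ "1::real"])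
      ultimately show ?thesis by blast
    next
      case False
      have large: "\<exists>M. \<forall>n\<ge>M. c \<le> m n" for c
      proof -
        have "{n. m n < c} = (\<Union>i<c. {n. m n = i})" by auto
        then have "finite {n. m n < c}" using False by auto
        then obtain M where "\<And>n. m n < c \<Longrightarrow> n < M"
          unfolding finite_nat_set_iff_bounded by auto
        then show ?thesis by (metis not_le)
      qed
      have "locunif_conv (s \<circ> id) (\<lambda>_. Some a) U"
        unfolding locunif_conv_def
      proof (intro ballI exI[of _ "1::real"] conjI allI impI)
        fix \<epsilon> :: real assume "\<epsilon> > 0"
        then obtain N where N: "\<And>j y. N \<le> j \<Longrightarrow> dist y a < r \<Longrightarrow> chordal ((f ^^ j) (Some y)) (Some a) < \<epsilon>"
          using trap_uniform[OF t] by blast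
        obtain M where M: "\<And>n. M \<le> n \<Longrightarrow> N + k \<le> m n" using large by blast
        have "chordal ((s \<circ> id) n y) (Some a) < \<epsilon>" if n: "M \<le> n" "y \<in> U" for n y
        proof -
          obtain y' where y': "(f ^^ k) y = Some y'" "dist y' a < r" using n(2) by (auto simp: U_def)
          have "(f ^^ m n) y = (f ^^ (m n - k)) (Some y')"
            using M[OF n(1)] y'(1) funpow_add[of "m n - k" k f] by simp
          then show ?thesis using N[of "m n - k" y'] M[OF n(1)] y'(2) by (simp add: m)
        qed
        then show "\<exists>M. \<forall>n\<ge>M. \<forall>y\<in>U. chordal x y < 1 \<longrightarrow> chordal ((s \<circ> id) n y) (Some a) < \<epsilon>" for x
          by blast
      qed simp
      then show ?thesis using strict_mono_id by blast
    qed
  qed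
  moreover have "sph_open U" unfolding U_def by (rule sph_open_trapped)
  moreover have "x \<in> U" using y by (simp add: U_def)
  ultimately show "x \<in> fatou_set f" unfolding fatou_set_def by blast
qed

text \<open>On a connected normal neighbourhood every basin is relatively closed: a limit of the iterates
  that equals the constant \<open>a\<close> on the basin of \<open>a\<close> keeps the value \<open>a\<close> at boundary points.\<close>

lemma fatou_ball_avoids_basins:
  assumes "Some z \<in> fatou_set f" "Some z \<notin> basins"
  obtains \<rho> where "\<rho> > 0" "\<And>w. w \<in> ball z \<rho> \<Longrightarrow> Some w \<notin> basins"
proof -
  obtain U where U: "sph_open U" "Some z \<in> U" "normal_family (range (\<lambda>k. f ^^ k)) U"
    using assms(1) unfolding fatou_set_def by blast
  obtain q g where q: "strict_mono q" "locunif_conv ((\<lambda>n. f ^^ n) \<circ> q) g U"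
    using U(3)[unfolded normal_family_def, rule_format, of "\<lambda>n. f ^^ n"] by blast
  obtain e where e: "e > 0" "\<And>\<epsilon>. \<epsilon> > 0 \<Longrightarrow> \<exists>N. \<forall>n\<ge>N. \<forall>y\<in>U. chordal (Some z) y < e \<longrightarrow>
      chordal (((\<lambda>n. f ^^ n) \<circ> q) n y) (g y) < \<epsilon>"
    using q(2) U(2) unfolding locunif_conv_def by blast
  obtain e' where e': "e' > 0" "\<And>y. chordal (Some z) y < e' \<Longrightarrow> y \<in> U"
    using U(1,2) unfolding sph_open_def by blast
  define \<rho> where "\<rho> = min e e' / 2"
  have \<rho>: "\<rho> > 0" using e e' by (simp add: \<rho>_def)
  have near: "chordal (Some z) (Some w) < e" "Some w \<in> U" if "w \<in> ball z \<rho>" for w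
    using that chordal_le_dist[of z w] by (auto simp: \<rho>_def min_def split: if_splits intro!: e'(2) simp del: chordal.simps)
  have unif: "\<exists>N. \<forall>n\<ge>N. \<forall>w\<in>ball z \<rho>. chordal ((f ^^ q n) (Some w)) (g (Some w)) < \<epsilon>" if pos: "\<epsilon> > 0" for \<epsilon>
  proof -
    obtain N where "\<And>n y. N \<le> n \<Longrightarrow> y \<in> U \<Longrightarrow> chordal (Some z) y < e \<Longrightarrow>
        chordal (((\<lambda>n. f ^^ n) \<circ> q) n y) (g y) < \<epsilon>"
      using e(2)[OF pos] by blast
    then have "\<And>n w. N \<le> n \<Longrightarrow> w \<in> ball z \<rho> \<Longrightarrow> chordal ((f ^^ q n) (Some w)) (g (Some w)) < \<epsilon>"
      using near unfolding o_def by blast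
    then show ?thesis by blast
  qed
  have "Some w \<notin> basin f (Some a)" if a: "a \<in> Z" and w: "w \<in> ball z \<rho>" for a w
  proof -
    define B where "B = {z. Some z \<in> basin f (Some a)}"
    have oB: "open B" unfolding B_def by (rule open_basin[OF a])
    obtain r \<kappa> where t: "trap a r \<kappa>" using trap_exists[OF a] .
    have "r > 0" using t by (simp add: trap_def)
    then obtain e0 where e0: "e0 > 0" "\<And>x. chordal (Some a) x < e0 \<Longrightarrow> \<exists>w. x = Some w \<and> dist a w < r"
      using chordal_Some_less_imp[of r a] by blast
    \<comment> \<open>Four triangle steps lead from the iterate of \<open>y\<close> to
      \<open>a\<close>: to the same iterate of a nearby basin point \<open>v\<close>, to the limit
      at \<open>v\<close>, to a late iterate of \<open>v\<close>, and to \<open>a\<close>.\<close>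
    define \<epsilon> where "\<epsilon> = e0 / 4"
    have \<epsilon>: "\<epsilon> > 0" using e0 by (simp add: \<epsilon>_def)
    obtain N where N: "\<And>n w. N \<le> n \<Longrightarrow> w \<in> ball z \<rho> \<Longrightarrow> chordal ((f ^^ q n) (Some w)) (g (Some w)) < \<epsilon>"
      using unif[OF \<epsilon>] by blast
    have closed: "y \<in> B" if y: "y \<in> ball z \<rho>" "y \<in> closure B" for y
    proof -
      obtain \<delta> where \<delta>: "\<delta> > 0"
          "\<And>x. chordal (Some y) x < \<delta> \<Longrightarrow> chordal ((f ^^ q N) (Some y)) ((f ^^ q N) x) < \<epsilon>"
        using funpow_cont[OF \<epsilon>] by blast
      have "open (ball z \<rho> \<inter> ball y (\<delta> / 2))" "y \<in> ball z \<rho> \<inter> ball y (\<delta> / 2)" using y \<delta>(1) by auto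
      then have "B \<inter> (ball z \<rho> \<inter> ball y (\<delta> / 2)) \<noteq> {}"
        using y(2) open_Int_closure_eq_empty[of "ball z \<rho> \<inter> ball y (\<delta> / 2)" B] by blast
      then obtain v where v: "v \<in> B" "v \<in> ball z \<rho>" "v \<in> ball y (\<delta> / 2)" by blast
      have 1: "chordal ((f ^^ q N) (Some y)) ((f ^^ q N) (Some v)) < \<epsilon>"
        using v(3) chordal_le_dist[of y v] by (intro \<delta>(2)) (auto simp del: chordal.simps)
      obtain n0 where n0: "\<And>k. n0 \<le> k \<Longrightarrow> chordal ((f ^^ k) (Some v)) (Some a) < \<epsilon>"
        using v(1) \<epsilon> unfolding B_def basin_def by blast
      define n where "n = max N n0"
      have "n0 \<le> q n" using seq_suble[OF q(1), of n] by (simp add: n_def)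
      then have 2: "chordal ((f ^^ q n) (Some v)) (Some a) < \<epsilon>" by (rule n0)
      have 3: "chordal ((f ^^ q N) (Some v)) (g (Some v)) < \<epsilon>" "chordal ((f ^^ q n) (Some v)) (g (Some v)) < \<epsilon>"
        using N v(2) by (simp_all add: n_def)
      have "chordal ((f ^^ q N) (Some y)) (Some a) < 4 * \<epsilon>"
        using 1 2 3 chordal_triangle[of "(f ^^ q N) (Some y)" "Some a" "(f ^^ q N) (Some v)"]
          chordal_triangle[of "(f ^^ q N) (Some v)" "Some a" "g (Some v)"]
          chordal_triangle[of "g (Some v)" "Some a" "(f ^^ q n) (Some v)"]
          chordal_commute[of "g (Some v)" "(f ^^ q n) (Some v)"] by linarith
      then obtain x where "(f ^^ q N) (Some y) = Some x" "dist a x < r"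
        using e0(2) chordal_commute unfolding \<epsilon>_def by (metis nonzero_mult_div_cancel_left times_divide_eq_right zero_neq_numeral)
      then show "y \<in> B"
        unfolding B_def basin_iff[OF t] mem_Collect_eq dist_commute[of _ a] by blast
    qed
    \<comment> \<open>\<open>B\<close> and the complement of its closure are open and together cover
      the disc, as \<open>B\<close> is relatively closed there; connectedness leaves only one of
      them.\<close>
    have "B \<inter> ball z \<rho> = {} \<or> - closure B \<inter> ball z \<rho> = {}"
      using closed closure_subset[of B] by (intro connectedD[OF connected_ball oB]) auto
    moreover have "z \<notin> closure B"
      using closed[of z] assms(2) \<rho> a by (auto simp: B_def basins_def)
    then have "z \<in> - closure B \<inter> ball z \<rho>" using \<rho> by auto
    ultimately have "B \<inter> ball z \<rho> = {}" by blast
    then show ?thesis using w by (auto simp: B_def)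
  qed
  then show ?thesis using that[OF \<rho>] by (auto simp: basins_def)
qed

text \<open>Points near infinity would lie in basins. A fixed iterate keeps them near infinity if
  they start close enough, while late iterates approach a point of \<open>Z\<close>; a locally
  uniform limit cannot accommodate both.\<close>

lemma None_notin_fatou:
  assumes "\<And>z. Some z \<in> fatou_set f \<Longrightarrow> Some z \<in> basins"
  shows "None \<notin> fatou_set f"
proof
  assume "None \<in> fatou_set f"
  then obtain U where U: "sph_open U" "None \<in> U" "normal_family (range (\<lambda>k. f ^^ k)) U"
    unfolding fatou_set_def by blast
  have Ub: "Some w \<in> basins" if "Some w \<in> U" for w
    using assms that U unfolding fatou_set_def by blast
  obtain q g where q: "strict_mono q" "locunif_conv ((\<lambda>n. f ^^ n) \<circ> q) g U"
    using U(3)[unfolded normal_family_def, rule_format, of "\<lambda>n. f ^^ n"] by blast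
  obtain e where e: "e > 0" "\<And>\<epsilon>. \<epsilon> > 0 \<Longrightarrow> \<exists>N. \<forall>n\<ge>N. \<forall>y\<in>U. chordal None y < e \<longrightarrow>
      chordal (((\<lambda>n. f ^^ n) \<circ> q) n y) (g y) < \<epsilon>"
    using q(2) U(2) unfolding locunif_conv_def by blast
  obtain e' where e': "e' > 0" "\<And>y. chordal None y < e' \<Longrightarrow> y \<in> U"
    using U(1,2) unfolding sph_open_def by blast
  \<comment> \<open>At most a quarter of the least chordal distance from \<open>Z\<close> to
    infinity: the contradiction uses four steps of less than \<epsilon> each.\<close>
  define \<epsilon> where "\<epsilon> = Min (insert 1 ((\<lambda>a. chordal (Some a) None) ` Z)) / 4"
  have \<epsilon>: "\<epsilon> > 0" "\<And>a. a \<in> Z \<Longrightarrow> 4 * \<epsilon> \<le> chordal (Some a) None"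
    unfolding \<epsilon>_def using finite_Z chordal_Some_None_pos
    by (auto simp: Min_gr_iff simp del: chordal.simps intro!: Min_le)
  obtain N where N: "\<And>n y. N \<le> n \<Longrightarrow> y \<in> U \<Longrightarrow> chordal None y < e \<Longrightarrow> chordal ((f ^^ q n) y) (g y) < \<epsilon>"
    using e(2)[OF \<epsilon>(1)] by (auto simp del: chordal.simps)
  obtain \<delta> where \<delta>: "\<delta> > 0" "\<And>x. chordal None x < \<delta> \<Longrightarrow> chordal ((f ^^ q N) None) ((f ^^ q N) x) < \<epsilon>"
    using funpow_cont[OF \<epsilon>(1)] by blast
  define m where "m = min e (min e' \<delta>)"
  have m: "m > 0" using e e' \<delta> by (simp add: m_def)
  define w where "w = complex_of_real (4 / m)"
  have "chordal None (Some w) \<le> 2 / cmod w" using m by (intro chordal_None_le) (simp add: w_def)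
  also have "\<dots> = m / 2" using m by (simp add: w_def norm_divide)
  also have "\<dots> < m" using m by simp
  finally have w: "chordal None (Some w) < e" "chordal None (Some w) < e'" "chordal None (Some w) < \<delta>"
    by (auto simp: m_def simp del: chordal.simps)
  have wU: "Some w \<in> U" by (rule e'(2)[OF w(2)])
  then obtain a where a: "a \<in> Z" "Some w \<in> basin f (Some a)" using Ub by (auto simp: basins_def)
  then obtain n0 where n0: "\<And>k. n0 \<le> k \<Longrightarrow> chordal ((f ^^ k) (Some w)) (Some a) < \<epsilon>"
    using \<epsilon>(1) unfolding basin_def by blast
  define n where "n = max N n0"
  have "n0 \<le> q n" using seq_suble[OF q(1), of n] by (simp add: n_def)
  then have 1: "chordal ((f ^^ q n) (Some w)) (Some a) < \<epsilon>" by (rule n0)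
  have 2: "chordal ((f ^^ q N) (Some w)) (g (Some w)) < \<epsilon>" "chordal ((f ^^ q n) (Some w)) (g (Some w)) < \<epsilon>"
    using N wU w(1) by (simp_all add: n_def)
  have 3: "chordal None ((f ^^ q N) (Some w)) < \<epsilon>" using \<delta>(2)[OF w(3)] by (simp del: chordal.simps)
  show False
    using 1 2 3 \<epsilon>(2)[OF a(1)] chordal_triangle[of None "Some a" "(f ^^ q N) (Some w)"]
      chordal_triangle[of "(f ^^ q N) (Some w)" "Some a" "g (Some w)"]
      chordal_triangle[of "g (Some w)" "Some a" "(f ^^ q n) (Some w)"]
      chordal_commute[of "g (Some w)" "(f ^^ q n) (Some w)"] chordal_commute[of "Some a" None] by linarith
qed


section \<open>Every basin contains a critical value\<close>

lemma trap_subset_basin: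
  assumes "trap a r \<kappa>" "dist y a < r"
  shows "Some y \<in> basin f (Some a)"
  unfolding basin_iff[OF assms(1)] using assms(2) by (intro exI[of _ "0::nat"] exI[of _ y]) auto

lemma funpow_fixed: "a \<in> Z \<Longrightarrow> (f ^^ n) (Some a) = Some a"
  by (induction n) (auto simp: fixed)

text \<open>A trap is forward invariant, so a preimage of a point outside it is outside it. Inverse
  branches therefore omit a disc.\<close>

lemma inverse_avoids_trap:
  assumes "trap b s \<kappa>" "(f ^^ n) (Some x) = Some y" "s \<le> dist y b"
  shows "s \<le> dist x b"
  using trap_funpow[OF assms(1), of x n] assms(2,3) by force

text \<open>Otherwise all inverse branches fixing \<open>a\<close> exist on one disc around \<open>a\<close>. They avoid a
  neighbourhood of another attracting fixed point, which bounds their derivatives at \<open>a\<close>,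
  although these grow geometrically.\<close>

lemma basin_contains_crit_val:
  assumes a: "a \<in> Z"
  shows "\<exists>v\<in>crit_vals. Some v \<in> basin f (Some a)"
proof (rule ccontr)
  assume none: "\<not> ?thesis"
  obtain b where b: "b \<in> Z" "b \<noteq> a" using another_in_Z by blast
  obtain r0 \<kappa> where "trap a r0 \<kappa>" using trap_exists[OF a] .
  \<comment> \<open>Half the distance from \<open>a\<close> to \<open>b\<close>, here and for
    \<open>s\<close>, keeps the two traps disjoint.\<close>
  define r where "r = min r0 (dist a b / 2)"
  have t: "trap a r \<kappa>"
    using trapD(1)[OF \<open>trap a r0 \<kappa>\<close>] b(2)
    by (intro trap_mono[OF \<open>trap a r0 \<kappa>\<close>]) (auto simp: r_def)
  obtain s0 \<kappa>' where "trap b s0 \<kappa>'" using trap_exists[OF b(1)] .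
  define s where "s = min s0 (dist a b / 2)"
  have t': "trap b s \<kappa>'"
    using trapD(1)[OF \<open>trap b s0 \<kappa>'\<close>] b(2)
    by (intro trap_mono[OF \<open>trap b s0 \<kappa>'\<close>]) (auto simp: s_def)
  have r: "r > 0" "s > 0" "0 \<le> \<kappa>" "\<kappa> < 1" using trapD[OF t] trapD[OF t'] by auto
  have far: "s \<le> dist y b" if "y \<in> ball a r" for y
    using that dist_triangle[of a b y] unfolding r_def s_def by auto
  have avoid: "ball a r \<inter> post_crit = {}"
  proof (rule ccontr)
    assume "ball a r \<inter> post_crit \<noteq> {}"
    then obtain y k v where y: "dist y a < r" "v \<in> crit_vals" "(f ^^ k) (Some v) = Some y"
      by (auto simp: post_crit_def dist_commute)
    then have "Some v \<in> basin f (Some a)"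
      using trap_subset_basin[OF t] funpow_in_basin_iff by metis
    then show False using none y(2) by blast
  qed
  \<comment> \<open>The Cauchy bound for \<open>1 / (g - b)\<close> with radius
    \<open>r / 2\<close>, times the factor that turns it into a bound for \<open>deriv g a\<close>.
    It does not depend on \<open>n\<close>.\<close>
  define M where "M = (1 / s) / (r / 2) * (cmod (a - b))\<^sup>2"
  have bound: "1 \<le> \<kappa> ^ n * M" for n
  proof -
    have "a \<in> ball a r" using r by simp
    then obtain g where g: "g holomorphic_on ball a r" "g a = a"
        "\<And>y. y \<in> ball a r \<Longrightarrow> (f ^^ n) (Some (g y)) = Some y"
      using inverse_branch[OF convex_ball avoid, of a n a] funpow_fixed[OF a] by blast
    have gb: "s \<le> cmod (g y - b)" if "y \<in> ball a r" for y
      using inverse_avoids_trap[OF t' g(3)[OF that] far[OF that]] by (simp add: dist_norm)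
    have gb0: "g y - b \<noteq> 0" if "y \<in> ball a r" for y
      using gb[OF that] r by auto
    define \<phi> where "\<phi> y = 1 / (g y - b)" for y
    have hol: "\<phi> holomorphic_on ball a r"
      unfolding \<phi>_def using g(1) gb0 by (intro holomorphic_intros) auto
    have sub: "cball a (r / 2) \<subseteq> ball a r" using r by auto
    have "cmod ((deriv ^^ 1) \<phi> a) \<le> fact 1 * (1 / s) / (r / 2) ^ 1"
    proof (rule Cauchy_inequality)
      show "\<phi> holomorphic_on ball a (r / 2)" using hol r by (auto intro: holomorphic_on_subset)
      show "continuous_on (cball a (r / 2)) \<phi>"
        using hol sub by (meson holomorphic_on_imp_continuous_on continuous_on_subset)
      show "cmod (\<phi> x) \<le> 1 / s" if "cmod (a - x) = r / 2" for x
      proof -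
        have "x \<in> ball a r" using that r by (simp add: dist_norm)
        then show ?thesis using gb[of x] r by (simp add: \<phi>_def norm_divide divide_simps mult_ac)
      qed
    qed (use r in auto)
    then have d\<phi>: "cmod (deriv \<phi> a) \<le> (1 / s) / (r / 2)" by simp
    have dg: "(g has_field_derivative deriv g a) (at a)"
      using g(1) r by (intro holomorphic_derivI[of g "ball a r"]) auto
    have "(\<phi> has_field_derivative - deriv g a / (a - b)\<^sup>2) (at a)"
      unfolding \<phi>_def using dg b(2) g(2)
      by (auto intro!: derivative_eq_intros simp: power2_eq_square field_simps)
    then have "deriv \<phi> a = - deriv g a / (a - b)\<^sup>2" by (rule DERIV_imp_deriv)
    then have "deriv g a = - (deriv \<phi> a * (a - b)\<^sup>2)" using b(2) by simp
    then have "cmod (deriv g a) = cmod (deriv \<phi> a) * (cmod (a - b))\<^sup>2"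
      by (simp only: norm_minus_cancel norm_mult norm_power)
    then have le: "cmod (deriv g a) \<le> M"
      unfolding M_def using d\<phi> by (simp only: mult_right_mono zero_le_power2)
    \<comment> \<open>Contraction of the n-th iterate bounds the difference quotients of its inverse
      \<open>g\<close> from below; the limit at \<open>a\<close> gives the same bound for the
      derivative.\<close>
    have "((\<lambda>y. cmod ((g y - g a) / (y - a))) \<longlongrightarrow> cmod (deriv g a)) (at a)"
      using dg by (intro tendsto_norm) (simp add: has_field_derivative_iff)
    then have "((\<lambda>y. \<kappa> ^ n * cmod ((g y - g a) / (y - a))) \<longlongrightarrow> \<kappa> ^ n * cmod (deriv g a)) (at a)"
      by (rule tendsto_mult_left)
    moreover have "eventually (\<lambda>y. 1 \<le> \<kappa> ^ n * cmod ((g y - g a) / (y - a))) (at a)"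
    proof -
      have "isCont g a" using dg DERIV_isCont by blast
      then have "eventually (\<lambda>y. dist (g y) (g a) < r) (at a)"
        using r(1) unfolding isCont_def by (rule tendstoD)
      moreover have "eventually (\<lambda>y. y \<in> ball a r - {a}) (at a)"
        using r by (intro eventually_at_in_open) auto
      ultimately show ?thesis
      proof eventually_elim
        case (elim y)
        then have "dist y a \<le> \<kappa> ^ n * dist (g y) a"
          using trap_funpow[OF t, of "g y" n] g(2,3) by auto
        then show ?case using elim g(2) by (simp add: norm_divide dist_norm field_simps)
      qed
    qed
    ultimately have "1 \<le> \<kappa> ^ n * cmod (deriv g a)" by (rule tendsto_lowerbound) auto
    also have "\<dots> \<le> \<kappa> ^ n * M" using le r by (intro mult_left_mono) auto
    finally show ?thesis .
  qed
  have "(\<lambda>n. \<kappa> ^ n * M) \<longlonglongrightarrow> 0 * M" using r by (intro tendsto_intros LIMSEQ_realpow_zero)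
  then have "1 \<le> 0 * M" using bound by (intro tendsto_lowerbound[of _ _ sequentially]) auto
  then show False by simp
qed

section \<open>Pulling back along an orbit: the complement of the basins has no interior\<close>

lemma finite_funpow_eq_None: "finite {z. (f ^^ n) (Some z) = None}"
proof (induction n)
  case (Suc n)
  have "{z. (f ^^ Suc n) (Some z) = None} \<subseteq>
      {z. poly Q z = 0} \<union> (\<Union>w\<in>{w. (f ^^ n) (Some w) = None}. fibre w)"
    by (auto simp: fibre_iff funpow_Suc_right simp del: funpow.simps)
  then show ?case
    by (rule finite_subset) (use Suc finite_fibre Q_nonzero poly_roots_finite in auto)
qed auto

text \<open>Each critical orbit has finitely many points before it enters a closed disc inside a
  trap. Closedness gives a segment outside the basins a positive distance from the postcritical set
  and from \<open>Z\<close>.\<close>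

lemma post_crit_closed_superset:
  assumes "\<And>v. v \<in> crit_vals \<Longrightarrow> Some v \<in> basins"
  obtains C where "closed C" "post_crit \<subseteq> C" "Z \<subseteq> C" "\<And>y. y \<in> C \<Longrightarrow> Some y \<in> basins"
proof -
  have "\<exists>C. closed C \<and> {y. \<exists>k. (f ^^ k) (Some v) = Some y} \<subseteq> C \<and> (\<forall>y\<in>C. Some y \<in> basins)"
    if v: "v \<in> crit_vals" for v
  proof -
    obtain a where a: "a \<in> Z" "Some v \<in> basin f (Some a)" using assms[OF v] by (auto simp: basins_def)
    obtain r \<kappa> where t: "trap a r \<kappa>" using trap_exists[OF a(1)] .
    have "r > 0" by (rule trapD[OF t])
    \<comment> \<open>The halved radius keeps the closed disc used below inside the open trap of
      radius \<open>r\<close>.\<close>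
    then have t2: "trap a (r / 2) \<kappa>" by (intro trap_mono[OF t]) auto
    obtain k y where ky: "(f ^^ k) (Some v) = Some y" "dist y a < r / 2"
      using a(2) basin_iff[OF t2] by blast
    define I where "I = (\<lambda>j. the ((f ^^ j) (Some v))) ` {..<k}"
    have fin: "finite {y. \<exists>j<k. (f ^^ j) (Some v) = Some y}"
      by (rule finite_subset[of _ I]) (force simp: I_def)+
    define C where "C = {y. \<exists>j<k. (f ^^ j) (Some v) = Some y} \<union> cball a (r / 2)"
    have "closed C" unfolding C_def using fin by (intro closed_Un finite_imp_closed closed_cball)
    moreover have "x \<in> C" if "(f ^^ j) (Some v) = Some x" for j x
    proof (cases "j < k")
      case False
      then have "(f ^^ j) (Some v) = (f ^^ (j - k)) (Some y)"
        using ky(1) funpow_add[of "j - k" k f] by simp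
      then show ?thesis using trap_funpow[OF t2 ky(2), of "j - k"] that by (auto simp: C_def dist_commute)
    qed (use that in \<open>auto simp: C_def\<close>)
    moreover have "Some x \<in> basins" if "x \<in> C" for x
      using that unfolding C_def
    proof (elim UnE)
      assume "x \<in> {y. \<exists>j<k. (f ^^ j) (Some v) = Some y}"
      then obtain j where "(f ^^ j) (Some v) = Some x" by blast
      then show ?thesis using assms[OF v] funpow_in_basins_iff[of j "Some v"] by simp
    next
      assume "x \<in> cball a (r / 2)"
      then have "dist x a < r" using \<open>r > 0\<close> by (simp add: dist_commute)
      then show ?thesis using trap_subset_basin[OF t] a(1) by (auto simp: basins_def)
    qed
    ultimately show ?thesis by (intro exI[of _ C]) blast
  qed
  then obtain C where C: "\<And>v. v \<in> crit_vals \<Longrightarrow> closed (C v) \<and>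
      {y. \<exists>k. (f ^^ k) (Some v) = Some y} \<subseteq> C v \<and> (\<forall>y\<in>C v. Some y \<in> basins)"
    by metis
  show ?thesis
  proof (rule that[of "(\<Union>v\<in>crit_vals. C v) \<union> Z"])
    show "closed ((\<Union>v\<in>crit_vals. C v) \<union> Z)"
      using C finite_crit_vals finite_Z by (intro closed_Un closed_UN finite_imp_closed) auto
    show "post_crit \<subseteq> (\<Union>v\<in>crit_vals. C v) \<union> Z"
      using C unfolding post_crit_def by blast
    show "Some y \<in> basins" if "y \<in> (\<Union>v\<in>crit_vals. C v) \<union> Z" for y
      using that C fixed_in_basin unfolding basins_def by blast
  qed auto
qed

text \<open>An orbit that stayed outside the disc of radius \<open>R\<close> from some time on would
  shrink geometrically, which is absurd. So it returns infinitely often to a compact disc.\<close>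

lemma bounded_orbit_subsequence:
  assumes x: "\<And>n. poly Q (x n) \<noteq> 0" "\<And>n. x (Suc n) = F (x n)"
  obtains \<sigma> w where "strict_mono \<sigma>" "(\<lambda>n. x (\<sigma> n)) \<longlonglongrightarrow> w"
proof -
  have "infinite {n. cmod (x n) \<le> R}"
  proof
    assume "finite {n. cmod (x n) \<le> R}"
    then obtain N where N: "\<And>n. cmod (x n) \<le> R \<Longrightarrow> n < N"
      unfolding finite_nat_set_iff_bounded by auto
    then have large: "R < cmod (x n)" if "N \<le> n" for n using that by (meson not_le)
    have le: "cmod (x (N + j)) \<le> up ^ j * cmod (x N)" for j
    proof (induction j)
      case (Suc j)
      have "cmod (x (N + Suc j)) \<le> up * cmod (x (N + j))"
        using infinity_repelling[of "x (N + j)"] large[of "N + j"] x(2) by auto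
      also have "\<dots> \<le> up * (up ^ j * cmod (x N))" using Suc infinity_const by (intro mult_left_mono) auto
      finally show ?case by simp
    qed simp
    have "(\<lambda>j. up ^ j * cmod (x N)) \<longlonglongrightarrow> 0 * cmod (x N)"
      using infinity_const by (intro tendsto_intros LIMSEQ_realpow_zero)
    moreover have "R \<le> up ^ j * cmod (x N)" for j
      using le[of j] large[of "N + j"] by simp
    ultimately have "R \<le> 0 * cmod (x N)" by (intro tendsto_lowerbound[of _ _ sequentially]) auto
    then show False using infinity_const by simp
  qed
  note inf = this
  define s where "s = enumerate {n. cmod (x n) \<le> R}"
  have s: "strict_mono s" unfolding s_def using inf by (rule strict_mono_enumerate)
  have "\<forall>n. (x \<circ> s) n \<in> cball 0 R"
    using enumerate_in_set[OF inf] by (simp add: s_def)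
  then obtain w q where "strict_mono q" "((x \<circ> s) \<circ> q) \<longlonglongrightarrow> w"
    using compact_cball[of "0::complex" R] unfolding compact_def by metis
  then show ?thesis using that[of "s \<circ> q" w] strict_mono_o[OF s, of q] by (simp add: o_def)
qed

text \<open>Were \<open>p\<close> in the basin of \<open>a\<close>, all points near \<open>p\<close>
  would enter a small trap after a fixed number of steps and stay there; then \<open>y\<close> would
  lie in it, although its distance from \<open>Z\<close> is at least \<open>d\<close>.\<close>

lemma inverse_branch_limit_notin_basins:
  assumes n: "filterlim n at_top sequentially"
    and h: "\<And>j. (f ^^ n j) (Some (h j)) = Some y" "h \<longlonglongrightarrow> p"
    and y: "d > 0" "\<And>a. a \<in> Z \<Longrightarrow> d \<le> dist y a"
  shows "Some p \<notin> basins"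
proof
  assume "Some p \<in> basins"
  then obtain a where a: "a \<in> Z" "Some p \<in> basin f (Some a)" by (auto simp: basins_def)
  obtain r0 \<kappa> where t0: "trap a r0 \<kappa>" using trap_exists[OF a(1)] .
  define r where "r = min r0 d"
  have t: "trap a r \<kappa>" using trapD(1)[OF t0] y(1) by (intro trap_mono[OF t0]) (auto simp: r_def)
  obtain k x where k: "(f ^^ k) (Some p) = Some x" "dist x a < r" using a(2) basin_iff[OF t] by blast
  define U where "U = {z. Some z \<in> {x. \<exists>y. (f ^^ k) x = Some y \<and> dist y a < r}}"
  have "open U" unfolding U_def by (rule open_if_sph_open[OF sph_open_trapped])
  moreover have "p \<in> U" using k by (simp add: U_def)
  ultimately have "eventually (\<lambda>j. h j \<in> U) sequentially" using h(2) by (rule topological_tendstoD[rotated])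
  moreover have "eventually (\<lambda>j. k \<le> n j) sequentially" using n by (simp add: filterlim_at_top)
  ultimately have "eventually (\<lambda>j. h j \<in> U \<and> k \<le> n j) sequentially" by eventually_elim simp
  then obtain j where j: "h j \<in> U" "k \<le> n j" by (auto simp: eventually_sequentially)
  then obtain v where v: "(f ^^ k) (Some (h j)) = Some v" "dist v a < r" by (auto simp: U_def)
  have "(f ^^ n j) (Some (h j)) = (f ^^ (n j - k)) (Some v)"
    using j(2) v(1) funpow_add[of "n j - k" k f] by simp
  then have "dist y a < r" using trap_funpow[OF t v(2), of "n j - k"] h(1)[of j] by auto
  then show False using y(2)[OF a(1)] by (simp add: r_def)
qed

text \<open>Pull a domain that meets both the complement of the basins and the basins back along the
  orbit of an interior point of the complement. A limit of these inverse branches takes values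
  outside the basins only, so by openness it is a constant, namely the interior point; but the
  inverse branches map some points into the basins.\<close>

lemma complement_of_basins_no_interior:
  assumes crit: "\<And>v. v \<in> crit_vals \<Longrightarrow> Some v \<in> basins"
    and \<rho>: "\<rho> > 0" "\<And>w. w \<in> ball z \<rho> \<Longrightarrow> Some w \<notin> basins"
  shows False
proof -
  define V where "V = {z. Some z \<in> basins}"
  have oV: "open V" unfolding V_def by (rule open_basins)
  \<comment> \<open>For each \<open>n\<close> only finitely many points reach infinity in
    \<open>n\<close> steps, so the uncountable disc contains a point whose orbit avoids
    infinity.\<close>
  have "countable (\<Union>n. {z. (f ^^ n) (Some z) = None})"
    by (intro countable_UN) (auto intro: countable_finite finite_funpow_eq_None)
  then have "\<not> ball z \<rho> \<subseteq> (\<Union>n. {z. (f ^^ n) (Some z) = None})"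
    using uncountable_ball[OF \<rho>(1)] countable_subset by blast
  then obtain z0 where "z0 \<in> ball z \<rho>" "z0 \<notin> (\<Union>n. {z. (f ^^ n) (Some z) = None})"
    unfolding subset_iff by metis
  then have z0: "z0 \<in> ball z \<rho>" "(f ^^ n) (Some z0) \<noteq> None" for n by simp_all
  define x where "x n = the ((f ^^ n) (Some z0))" for n
  have x: "(f ^^ n) (Some z0) = Some (x n)" for n using z0(2)[of n] by (auto simp: x_def)
  have xQ: "poly Q (x n) \<noteq> 0" for n
  proof
    assume "poly Q (x n) = 0"
    then have "(f ^^ Suc n) (Some z0) = None" by (simp add: x)
    then show False using z0(2) by blast
  qed
  have xF: "x (Suc n) = F (x n)" for n
    using x[of "Suc n"] xQ[of n] by (simp add: x)
  have xV: "x n \<notin> V" for n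
    using \<rho>(2)[OF z0(1)] funpow_in_basins_iff[of n "Some z0"] by (simp add: V_def x)
  obtain \<sigma> w where \<sigma>: "strict_mono \<sigma>" "(\<lambda>n. x (\<sigma> n)) \<longlonglongrightarrow> w"
    using bounded_orbit_subsequence[of x, OF xQ xF] .
  have wV: "w \<notin> V"
    using closed_sequentially[of "- V" "\<lambda>n. x (\<sigma> n)" w] oV xV \<sigma>(2) by (auto simp: closed_def)
  obtain C where C: "closed C" "post_crit \<subseteq> C" "Z \<subseteq> C" "\<And>y. y \<in> C \<Longrightarrow> Some y \<in> basins"
    using post_crit_closed_superset[OF crit] by blast
  obtain a where a: "a \<in> Z" using another_in_Z by blast
  then have "a \<in> V" using C(3,4) by (auto simp: V_def)
  then obtain b where b: "closed_segment w b \<inter> V = {}" "b \<in> closure V"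
    using first_exit_segment[OF oV wV] by blast
  have "closed_segment w b \<inter> C = {}" using b(1) C(4) by (auto simp: V_def)
  then obtain D d where D: "convex D" "open D" "w \<in> D" "b \<in> D" "d > 0"
      "\<And>x y. x \<in> D \<Longrightarrow> y \<in> C \<Longrightarrow> d \<le> dist x y"
    using segment_neighbourhood[OF C(1)] by blast
  have avoid: "D \<inter> post_crit = {}" using D(5,6) C(2) by fastforce
  have farZ: "d \<le> dist y a'" if "y \<in> D" "a' \<in> Z" for y a' using D(6) C(3) that by blast
  \<comment> \<open>The neighbourhood reaches into the basins because its point \<open>b\<close>
    lies in their closure.\<close>
  have "V \<inter> D \<noteq> {}"
    using open_Int_closure_eq_empty[OF D(2), of V] b(2) D(4) by blast
  then obtain y0 where y0: "y0 \<in> D" "Some y0 \<in> basins" by (auto simp: V_def)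
  have "eventually (\<lambda>n. x (\<sigma> n) \<in> D) sequentially"
    using \<sigma>(2) D(2,3) by (rule topological_tendstoD)
  then obtain N where N: "\<And>n. N \<le> n \<Longrightarrow> x (\<sigma> n) \<in> D" by (auto simp: eventually_sequentially)
  define m where "m j = \<sigma> (N + j)" for j
  have m_mono: "strict_mono m" using \<sigma>(1) by (auto simp: m_def strict_mono_def)
  have xm: "x (m j) \<in> D" for j using N by (simp add: m_def)
  have "\<exists>g. g holomorphic_on D \<and> g (x (m j)) = z0 \<and> (\<forall>y\<in>D. (f ^^ m j) (Some (g y)) = Some y)" for j
    using inverse_branch[OF D(1) avoid xm x] by metis
  then obtain G where G: "\<And>j. G j holomorphic_on D" "\<And>j. G j (x (m j)) = z0"
      "\<And>j y. y \<in> D \<Longrightarrow> (f ^^ m j) (Some (G j y)) = Some y"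
    by metis
  obtain r0 \<kappa> where t0: "trap a r0 \<kappa>" using trap_exists[OF a] .
  define \<delta> where "\<delta> = min r0 d"
  have t: "trap a \<delta> \<kappa>" using trapD(1)[OF t0] D(5) by (intro trap_mono[OF t0]) (auto simp: \<delta>_def)
  have \<delta>: "\<delta> > 0" by (rule trapD[OF t])
  have Ga: "\<delta> \<le> cmod (G j y - a)" if "y \<in> D" for j y
    using inverse_avoids_trap[OF t G(3)[OF that, of j]] farZ[OF that a] by (simp add: \<delta>_def dist_norm)
  have Ga0: "G j y \<noteq> a" if "y \<in> D" for j y using Ga[OF that, of j] \<delta> by auto
  \<comment> \<open>Reciprocals turn the omitted disc into a uniform bound, which Montel's theorem
    requires.\<close>
  define \<phi> where "\<phi> j y = 1 / (G j y - a)" for j y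
  have \<phi>0: "\<phi> j y \<noteq> 0" "a + 1 / \<phi> j y = G j y" if "y \<in> D" for j y
    using Ga0[OF that, of j] by (auto simp: \<phi>_def)
  have hol: "\<phi> j holomorphic_on D" for j
    unfolding \<phi>_def using G(1)[of j] Ga0 by (intro holomorphic_intros) auto
  have bd: "cmod (\<phi> j y) \<le> 1 / \<delta>" if "y \<in> D" for j y
    using Ga[OF that, of j] \<delta> Ga0[OF that, of j] by (simp add: \<phi>_def norm_divide field_simps)
  obtain \<Phi> q where \<Phi>: "\<Phi> holomorphic_on D" "strict_mono (q :: nat \<Rightarrow> nat)"
      "\<And>y. y \<in> D \<Longrightarrow> (\<lambda>n. \<phi> (q n) y) \<longlonglongrightarrow> \<Phi> y"
      "\<And>K. compact K \<Longrightarrow> K \<subseteq> D \<Longrightarrow> uniform_limit K (\<phi> \<circ> q) \<Phi> sequentially"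
  proof (rule Montel[OF D(2), of "range \<phi>" \<phi>])
    show "\<exists>B. \<forall>h\<in>range \<phi>. \<forall>z\<in>K. cmod (h z) \<le> B" if "K \<subseteq> D" for K
      using bd that by (intro exI[of _ "1 / \<delta>"]) blast
  qed (use hol in auto)
  have mq: "strict_mono (\<lambda>n. m (q n))" using strict_mono_o[OF m_mono \<Phi>(2)] by (simp add: o_def)
  then have mq_top: "filterlim (\<lambda>n. m (q n)) at_top sequentially" by (rule filterlim_subseq)
  have "strict_mono (\<lambda>n. N + q n)" using \<Phi>(2) by (simp add: strict_mono_def)
  then have x_lim: "(\<lambda>n. x (m (q n))) \<longlonglongrightarrow> w"
    using LIMSEQ_subseq_LIMSEQ[OF \<sigma>(2), of "\<lambda>n. N + q n"] by (simp add: o_def m_def)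
  have "(\<lambda>n. (\<phi> \<circ> q) n (x (m (q n)))) \<longlonglongrightarrow> \<Phi> w"
  proof (rule diagonal_uniform_limit[OF D(2,3) \<Phi>(1) _ x_lim])
    show "uniform_limit K (\<phi> \<circ> q) \<Phi> sequentially" if "compact K" "K \<subseteq> D" for K
      by (rule \<Phi>(4)[OF that])
  qed
  \<comment> \<open>Every branch sends its own orbit point to \<open>z0\<close>, so the sequence is
    constant.\<close>
  then have "(\<lambda>n::nat. 1 / (z0 - a)) \<longlonglongrightarrow> \<Phi> w" by (simp add: \<phi>_def G(2))
  then have \<Phi>w: "\<Phi> w = 1 / (z0 - a)" using LIMSEQ_unique tendsto_const by blast
  have GV: "Some (G j y0) \<in> basins" for j
    using funpow_in_basins_iff[of "m j" "Some (G j y0)"] G(3)[OF y0(1), of j] y0(2) by simp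
  have lim: "Some (a + 1 / \<Phi> y) \<notin> basins" if y: "y \<in> D" "\<Phi> y \<noteq> 0" for y
  proof (rule inverse_branch_limit_notin_basins[OF mq_top])
    show "(f ^^ m (q j)) (Some (G (q j) y)) = Some y" for j by (rule G(3)[OF y(1)])
    have "(\<lambda>n. a + 1 / \<phi> (q n) y) \<longlonglongrightarrow> a + 1 / \<Phi> y"
      using \<Phi>(3)[OF y(1)] y(2) by (intro tendsto_intros)
    then show "(\<lambda>n. G (q n) y) \<longlonglongrightarrow> a + 1 / \<Phi> y" using \<phi>0(2)[OF y(1)] by simp
  qed (use D(5) farZ[OF y(1)] in auto)
  show False
  proof (cases "\<Phi> constant_on D")
    case True
    then have "\<Phi> y0 = 1 / (z0 - a)" using \<Phi>w D(3) y0(1) by (metis constant_on_def)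
    moreover have "z0 \<noteq> a" using \<rho>(2)[OF z0(1)] a fixed_in_basin by (auto simp: basins_def)
    ultimately have y00: "\<Phi> y0 \<noteq> 0" "a + 1 / \<Phi> y0 = z0" by auto
    have "(\<lambda>n. a + 1 / \<phi> (q n) y0) \<longlonglongrightarrow> a + 1 / \<Phi> y0"
      using \<Phi>(3)[OF y0(1)] y00(1) by (intro tendsto_intros)
    then have "(\<lambda>n. G (q n) y0) \<longlonglongrightarrow> z0" using \<phi>0(2)[OF y0(1)] y00(2) by simp
    then have "eventually (\<lambda>n. G (q n) y0 \<in> ball z \<rho>) sequentially"
      using open_ball z0(1) by (rule topological_tendstoD)
    then obtain n where "G (q n) y0 \<in> ball z \<rho>" by (auto simp: eventually_sequentially)
    then show False using \<rho>(2) GV by blast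
  next
    case False
    \<comment> \<open>The open image of a nonconstant limit contains \<open>\<phi> (q n) y0\<close>
      for large \<open>n\<close>. So \<open>G (q n) y0\<close> coincides with a limit value and lies
      outside the basins, against \<open>GV\<close>.\<close>
    have "open (\<Phi> ` D)"
      using open_mapping_thm[OF \<Phi>(1) D(2) convex_connected[OF D(1)] D(2) subset_refl False] .
    moreover have "\<Phi> y0 \<in> \<Phi> ` D" using y0(1) by blast
    ultimately have "eventually (\<lambda>n. \<phi> (q n) y0 \<in> \<Phi> ` D) sequentially"
      using \<Phi>(3)[OF y0(1)] by (rule topological_tendstoD[rotated])
    then obtain n y where "\<phi> (q n) y0 = \<Phi> y" "y \<in> D" by (auto simp: eventually_sequentially)
    then have "Some (G (q n) y0) \<notin> basins" using lim[of y] \<phi>0[OF y0(1), of "q n"] by simp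
    then show False using GV by blast
  qed
qed

theorem fatou_eq_basins:
  assumes "\<And>v. v \<in> crit_vals \<Longrightarrow> Some v \<in> basins"
  shows "fatou_set f = (\<Union>a\<in>Z. basin f (Some a))"
proof
  have fin: "Some z \<in> basins" if "Some z \<in> fatou_set f" for z
  proof (rule ccontr)
    assume "Some z \<notin> basins"
    then show False
      using fatou_ball_avoids_basins[OF that] complement_of_basins_no_interior[OF assms] by blast
  qed
  show "fatou_set f \<subseteq> (\<Union>a\<in>Z. basin f (Some a))"
  proof
    fix x assume "x \<in> fatou_set f"
    then show "x \<in> (\<Union>a\<in>Z. basin f (Some a))"
      using None_notin_fatou[OF fin] fin unfolding basins_def by (cases x) auto
  qed
qed (use basin_subset_fatou in blast)

end

section \<open>Relaxed Newton maps\<close>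

lemma degree_eq_sum_order:
  fixes p :: "complex poly"
  assumes "p \<noteq> 0"
  shows "degree p = (\<Sum>z\<in>roots p. order z p)"
proof -
  have "degree p = degree (\<Prod>z\<in>roots p. [:-z, 1:] ^ order z p)"
    using complex_poly_decompose[of p] assms unfolding roots_def
    by (metis degree_smult_eq leading_coeff_0_iff)
  also have "\<dots> = (\<Sum>z\<in>roots p. order z p)"
    by (subst degree_prod_sum_eq) (auto simp: degree_linear_power)
  finally show ?thesis .
qed

section \<open>The reduced form of the relaxed Newton map\<close>

locale newton =
  fixes p :: "complex poly" and h :: complex
  assumes p_nonzero: "p \<noteq> 0" and two_roots: "\<exists>b\<in>roots p. b \<noteq> a" and adm: "admissible p h"
begin

text \<open>\<open>A / Q\<close> is the quotient of \<open>p\<close> by its derivative in lowest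
  terms; \<open>A\<close> has the roots of \<open>p\<close>, all simple, and the Newton map becomes
  \<open>P / Q\<close>.\<close>

definition "G = gcd p (pderiv p)"
definition "A = p div G"
definition "Q = pderiv p div G"
definition "P = [:0, 1:] * Q - smult h A"

lemma G_nonzero: "G \<noteq> 0" using p_nonzero by (simp add: G_def)

lemma p_eq: "G * A = p" and pderiv_eq: "G * Q = pderiv p"
  by (simp_all add: A_def Q_def G_def)

lemma A_nonzero: "A \<noteq> 0" using p_eq p_nonzero by auto

lemma finite_roots: "finite (roots p)"
  using p_nonzero by (simp add: roots_def poly_roots_finite)

lemma card_roots_ge: "2 \<le> card (roots p)"
proof -
  obtain a b where ab: "a \<in> roots p" "b \<in> roots p" "b \<noteq> a" using two_roots by blast
  then have "card {a, b} \<le> card (roots p)" by (intro card_mono finite_roots) auto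
  then show ?thesis using ab(3) by simp
qed

lemma coprime_A_Q: "coprime A Q"
  unfolding A_def Q_def G_def using p_nonzero by (intro div_gcd_coprime) auto

lemma no_common_root_A_Q: "poly Q z = 0 \<Longrightarrow> poly A z \<noteq> 0"
  using coprime_poly_0[OF coprime_A_Q, of z] by auto

lemma degree_p_pos: "0 < degree p"
proof (rule ccontr)
  assume "\<not> 0 < degree p"
  then have "roots p = {}" using p_nonzero by (auto simp: roots_def elim!: degree_eq_zeroE)
  then show False using card_roots_ge by simp
qed

lemma pderiv_nonzero: "pderiv p \<noteq> 0" using degree_p_pos by (simp add: pderiv_eq_0_iff)

lemma Q_nonzero': "Q \<noteq> 0" using pderiv_nonzero pderiv_eq by auto

text \<open>At a root of multiplicity k, \<open>p\<close> vanishes to one order more than its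
  derivative, which leaves a simple zero in \<open>A\<close> and none in \<open>Q\<close>.
  Cancelling the common power of X - a in \<open>pderiv p\<close> yields the last equation, from
  which the multiplier 1 - h / k follows.\<close>

lemma root_structure:
  assumes a: "a \<in> roots p"
  shows "poly A a = 0" "poly Q a \<noteq> 0" "poly Q a = of_nat (order a p) * poly (pderiv A) a"
proof -
  define k where "k = order a p"
  have pa: "poly p a = 0" using a by (simp add: roots_def)
  define j where "j = order a (pderiv p)"
  have k: "k = Suc j" unfolding k_def j_def by (rule order_pderiv[OF p_nonzero pa])
  have 1: "k = order a G + order a A" unfolding k_def using p_nonzero p_eq order_mult by metis
  have 2: "j = order a G + order a Q" unfolding j_def using pderiv_nonzero pderiv_eq order_mult by metis
  have 3: "order a A = Suc (order a Q)" using 1 2 k by simp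
  then show A0: "poly A a = 0" using order_root[of A a] by simp
  show Q0: "poly Q a \<noteq> 0" using no_common_root_A_Q A0 by blast
  then have oG: "order a G = j" using 1 3 k Q_nonzero' by (auto simp: order_eq_0_iff)
  define X where "X = [:-a, 1:]"
  obtain s where s: "G = X ^ (j) * s" "\<not> X dvd s"
    using order_decomp[OF G_nonzero, of a] unfolding oG X_def by blast
  obtain t where t: "A = X * t" using A0 unfolding X_def poly_eq_0_iff_dvd by blast
  have "p = X ^ Suc (j) * (s * t)" using p_eq s(1) t by (simp add: algebra_simps)
  then have "pderiv p = X ^ Suc (j) * pderiv (s * t) + smult (of_nat (Suc (j))) ((s * t) * X ^ (j))"
    unfolding X_def by (metis lemma_order_pderiv1)
  then have "X ^ (j) * (s * Q) = X ^ (j) * (X * pderiv (s * t) + smult (of_nat k) (s * t))"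
    unfolding k using s(1) pderiv_eq by (simp add: algebra_simps)
  moreover have "X ^ (j) \<noteq> 0" by (simp add: X_def)
  ultimately have "s * Q = X * pderiv (s * t) + smult (of_nat k) (s * t)" 
    using mult_left_cancel[of "X ^ j"] by blast
  then have "poly (s * Q) a = poly (X * pderiv (s * t) + smult (of_nat k) (s * t)) a" by simp
  then have "poly s a * poly Q a = of_nat k * (poly s a * poly t a)" by (simp add: X_def)
  moreover have "poly s a \<noteq> 0" using s(2) by (simp add: X_def poly_eq_0_iff_dvd)
  ultimately have "poly Q a = of_nat k * poly t a" by simp
  moreover have "poly (pderiv A) a = poly t a"
    unfolding t X_def by (simp add: pderiv_mult pderiv_pCons del: mult_pCons_left)
  ultimately show "poly Q a = of_nat (order a p) * poly (pderiv A) a" by (simp add: k_def)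
qed

lemma roots_A: "{z. poly A z = 0} = roots p"
  using root_structure(1) poly_mult[of G A] by (auto simp: roots_def p_eq)

lemma degree_A: "degree A = card (roots p)"
proof -
  have "rsquarefree A"
    unfolding rsquarefree_roots
  proof (intro allI notI, elim conjE)
    fix a assume "poly A a = 0" "poly (pderiv A) a = 0"
    then show False using root_structure(2,3)[of a] roots_A by auto
  qed
  then show ?thesis
    using card_roots_eq_degree_iff_rsquarefree[OF A_nonzero] roots_A by simp
qed

lemma degree_Q: "Suc (degree Q) = degree A"
proof -
  have "degree (pderiv p) = degree G + degree Q"
    using pderiv_eq Q_nonzero' G_nonzero degree_mult_eq by metis
  moreover have "degree p = degree G + degree A"
    using p_eq A_nonzero G_nonzero degree_mult_eq by metis
  moreover have "degree (pderiv p) = degree p - 1" by (rule degree_pderiv)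
  moreover have "2 \<le> degree A" using degree_A card_roots_ge by simp
  ultimately show ?thesis by linarith
qed

lemma lead_coeff_Q: "lead_coeff Q = of_nat (degree p) * lead_coeff A"
proof -
  have "lead_coeff G * lead_coeff Q = lead_coeff (pderiv p)"
    unfolding pderiv_eq[symmetric] by (rule lead_coeff_mult[symmetric])
  also have "\<dots> = of_nat (degree p) * lead_coeff p"
    using degree_p_pos by (simp add: degree_pderiv coeff_pderiv)
  also have "lead_coeff p = lead_coeff G * lead_coeff A"
    using p_eq lead_coeff_mult by metis
  finally show ?thesis using G_nonzero by simp
qed

section \<open>Consequences of admissibility at the roots and at infinity\<close>

lemma min_mult_le: "a \<in> roots p \<Longrightarrow> min_mult p \<le> order a p"
  unfolding min_mult_def using finite_roots by (intro Min_le) auto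

text \<open>The discs with centre and radius k increase with k. The case of a root multiplicity
  makes the root attracting, the case k = degree p makes infinity repelling.\<close>

lemma adm_le:
  assumes "min_mult p \<le> k"
  shows "cmod (of_nat k - h) < of_nat k"
proof -
  have "cmod (of_nat k - h) = cmod (of_real (real k - real (min_mult p)) + (of_nat (min_mult p) - h))" by simp
  also have "\<dots> \<le> \<bar>real k - real (min_mult p)\<bar> + cmod (of_nat (min_mult p) - h)"
    by (rule order_trans[OF norm_triangle_ineq]) (simp del: of_real_diff)
  also have "\<dots> < real k"
    using adm assms unfolding admissible_def by (simp add: norm_minus_commute)
  finally show ?thesis .
qed

lemma h_nonzero: "h \<noteq> 0"
  using adm by (auto simp: admissible_def)

lemma degree_p_ge: "2 * min_mult p \<le> degree p"
proof -
  have "2 * min_mult p \<le> card (roots p) * min_mult p" using card_roots_ge by simp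
  also have "\<dots> = (\<Sum>z\<in>roots p. min_mult p)" by simp
  also have "\<dots> \<le> (\<Sum>z\<in>roots p. order z p)" by (intro sum_mono min_mult_le)
  finally show ?thesis using degree_eq_sum_order[OF p_nonzero] by simp
qed

text \<open>With two roots the degree is at least twice the least multiplicity, which exceeds the
  modulus of \<open>h\<close>. Thus the leading terms of \<open>P\<close> do not cancel.\<close>

lemma degree_p_neq_h: "of_nat (degree p) \<noteq> h"
proof
  assume eq: "of_nat (degree p) = h"
  have "cmod h \<le> cmod (h - of_nat (min_mult p)) + cmod (of_nat (min_mult p))"
    using norm_triangle_ineq[of "h - of_nat (min_mult p)" "of_nat (min_mult p)"] by simp
  also have "\<dots> < 2 * real (min_mult p)" using adm by (simp add: admissible_def)
  also have "\<dots> \<le> real (degree p)" using degree_p_ge by linarith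
  finally show False using eq by auto
qed

lemma coeff_P: "coeff P (degree A) = (of_nat (degree p) - h) * lead_coeff A"
proof -
  have "coeff ([:0, 1:] * Q) (degree A) = lead_coeff Q"
    by (simp add: coeff_pCons degree_Q[symmetric])
  then show ?thesis by (simp add: P_def lead_coeff_Q algebra_simps del: mult_pCons_left)
qed

lemma degree_P: "degree P = degree A"
proof (rule antisym)
  have "degree ([:0, 1:] * Q) \<le> degree A" using degree_pCons_le[of 0 Q] degree_Q by simp
  moreover have "degree (smult h A) \<le> degree A" by (rule degree_smult_le)
  ultimately show "degree P \<le> degree A" unfolding P_def by (rule degree_diff_le)
  have "coeff P (degree A) \<noteq> 0" using coeff_P degree_p_neq_h A_nonzero by simp
  then show "degree A \<le> degree P" by (rule le_degree)
qed

sublocale rational_map P Q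
proof
  show "degree Q < degree P" using degree_P degree_Q by simp
  fix z assume "poly Q z = 0"
  then show "poly P z \<noteq> 0" using no_common_root_A_Q[of z] h_nonzero by (simp add: P_def)
qed

lemma poly_P: "poly P z = z * poly Q z - h * poly A z"
  by (simp add: P_def)

lemma poly_pderiv_P: "poly (pderiv P) z = poly Q z + z * poly (pderiv Q) z - h * poly (pderiv A) z"
  unfolding P_def by (simp add: pderiv_diff pderiv_smult pderiv_pCons)

lemma F_eq: "poly Q z \<noteq> 0 \<Longrightarrow> F z = z - h * poly A z / poly Q z"
  by (simp add: F_def poly_P field_simps)

lemma poly_wronskian:
  "poly wronskian z = (poly Q z)\<^sup>2
     - h * (poly (pderiv A) z * poly Q z - poly A z * poly (pderiv Q) z)"
  unfolding wronskian_def by (simp add: poly_P poly_pderiv_P power2_eq_square algebra_simps)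

lemma deriv_F_at_root:
  assumes "a \<in> roots p"
  shows "cmod (deriv F a) < 1"
proof -
  note r = root_structure[OF assms]
  define k where "k = order a p"
  have k: "of_nat k \<noteq> (0::complex)" "poly (pderiv A) a \<noteq> 0" using r by (auto simp: k_def)
  have "deriv F a = poly wronskian a / (poly Q a)\<^sup>2"
    by (rule DERIV_imp_deriv[OF F_has_field_derivative[OF r(2)]])
  also have "\<dots> = 1 - h * (poly (pderiv A) a / poly Q a)"
    using r(1,2) by (simp add: poly_wronskian power2_eq_square field_simps)
  also have "poly (pderiv A) a / poly Q a = 1 / of_nat k"
    unfolding r(3) k_def[symmetric] using k by simp
  also have "1 - h * (1 / of_nat k) = (of_nat k - h) / of_nat k" using k by (simp add: field_simps)
  finally have "cmod (deriv F a) = cmod (of_nat k - h) / real k" by (simp add: norm_divide)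
  also have "\<dots> < 1"
    using adm_le[OF min_mult_le[OF assms]] k(1) by (simp add: k_def divide_less_eq)
  finally show ?thesis .
qed

text \<open>Since \<open>h\<close> is nonzero, z p' - h p and p' have the same common divisors as p
  and p', so the reduction in \<open>rat_map\<close> divides by \<open>G\<close>.\<close>

lemma relaxed_newton_eq: "relaxed_newton h p = sphere_map"
proof
  fix x
  define S where "S = [:0, 1:] * pderiv p - smult h p"
  have "gcd S (pderiv p) = gcd (pderiv p) ([:0, 1:] * pderiv p + p * [:-h:])"
    by (simp add: S_def gcd.commute)
  also have "\<dots> = gcd (pderiv p) (p * [:-h:])" by (rule gcd_add_mult)
  also have "\<dots> = gcd (pderiv p) p"
    using h_nonzero by (intro gcd_mult_unit2) (simp add: is_unit_const_poly_iff dvd_field_iff)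
  finally have gcd: "gcd S (pderiv p) = G" by (simp add: G_def gcd.commute)
  have "S = [:0, 1:] * (G * Q) - smult h (G * A)"
    unfolding S_def pderiv_eq p_eq ..
  also have "\<dots> = G * P" by (simp add: P_def algebra_simps del: mult_pCons_left)
  finally have S: "S = G * P" .
  have "S div G = P" unfolding S using G_nonzero by simp
  moreover have "pderiv p div G = Q" by (simp add: Q_def)
  ultimately show "relaxed_newton h p x = sphere_map x"
    unfolding relaxed_newton_def rat_map_def S_def[symmetric] gcd Let_def
    using degree_less by (simp add: sphere_map_def F_def split: option.split)
qed

text \<open>\<open>F z / z\<close> tends to l = 1 - h / degree p with 0 < |l| < 1, the reciprocal of
  the multiplier at infinity. The two constants are the midpoints between 0, |l| and 1.\<close>

lemma F_near_infinity:
  obtains R lo up where "0 < R" "0 < lo" "0 \<le> up" "up < 1"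
    "\<And>z. R \<le> cmod z \<Longrightarrow> poly Q z \<noteq> 0 \<and> lo * cmod z \<le> cmod (F z) \<and> cmod (F z) \<le> up * cmod z"
proof -
  define n where "n = degree p"
  define l where "l = (of_nat n - h) / of_nat n"
  have n: "n > 0" "min_mult p \<le> n" using degree_p_pos degree_p_ge by (auto simp: n_def)
  have l0: "cmod l > 0" using degree_p_neq_h n by (simp add: l_def n_def)
  have l1: "cmod l < 1" using adm_le[OF n(2)] n(1) by (simp add: l_def norm_divide)
  have Qd: "degree ([:0, 1:] * Q) = degree A" "coeff ([:0, 1:] * Q) (degree A) = lead_coeff Q"
    using Q_nonzero' by (simp_all add: degree_Q[symmetric])
  have "((\<lambda>z. poly ([:0, 1:] * Q) z / z ^ degree A) \<longlongrightarrow> lead_coeff Q) at_infinity"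
    using poly_divide_tendsto_aux[of "[:0, 1:] * Q"] by (simp only: Qd)
  moreover have "((\<lambda>z. poly P z / z ^ degree A) \<longlongrightarrow> coeff P (degree A)) at_infinity"
    using poly_divide_tendsto_aux[of P] by (simp only: degree_P)
  ultimately have "((\<lambda>z. (poly P z / z ^ degree A) / (poly ([:0, 1:] * Q) z / z ^ degree A))
      \<longlongrightarrow> coeff P (degree A) / lead_coeff Q) at_infinity"
    using Q_nonzero' by (intro tendsto_divide) auto
  also have "coeff P (degree A) / lead_coeff Q = l"
    using coeff_P lead_coeff_Q A_nonzero n by (simp add: l_def n_def)
  finally have "((\<lambda>z. (poly P z / z ^ degree A) / (poly ([:0, 1:] * Q) z / z ^ degree A)) \<longlongrightarrow> l) at_infinity" .
  moreover have "eventually (\<lambda>z::complex. 1 \<le> cmod z) at_infinity" unfolding eventually_at_infinity by blast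
  then have "eventually (\<lambda>z. (poly P z / z ^ degree A) / (poly ([:0, 1:] * Q) z / z ^ degree A) = F z / z) at_infinity"
    by eventually_elim (auto simp: F_def)
  ultimately have "((\<lambda>z. F z / z) \<longlongrightarrow> l) at_infinity" by (rule Lim_transform_eventually)
  then have lim: "((\<lambda>z. cmod (F z / z)) \<longlongrightarrow> cmod l) at_infinity" by (rule tendsto_norm)
  have "eventually (\<lambda>z. cmod l / 2 < cmod (F z / z)) at_infinity"
    using l0 by (intro order_tendstoD(1)[OF lim]) simp
  moreover have "eventually (\<lambda>z. cmod (F z / z) < (1 + cmod l) / 2) at_infinity"
    using l1 by (intro order_tendstoD(2)[OF lim]) simp
  ultimately have "eventually (\<lambda>z. cmod l / 2 < cmod (F z / z) \<and> cmod (F z / z) < (1 + cmod l) / 2) at_infinity"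
    by (rule eventually_conj)
  then obtain B where B: "\<And>z. B \<le> cmod z \<Longrightarrow> cmod l / 2 < cmod (F z / z) \<and> cmod (F z / z) < (1 + cmod l) / 2"
    unfolding eventually_at_infinity by blast
  show ?thesis
  proof (rule that[of "max B 1" "cmod l / 2" "(1 + cmod l) / 2"])
    fix z assume z: "max B 1 \<le> cmod z"
    then have b: "cmod l / 2 < cmod (F z / z)" "cmod (F z / z) < (1 + cmod l) / 2" using B by auto
    have "z \<noteq> 0" using z by auto
    have "poly Q z \<noteq> 0" using b(1) l0 by (auto simp: F_def)
    moreover have "cmod l / 2 * cmod z \<le> cmod (F z)" "cmod (F z) \<le> (1 + cmod l) / 2 * cmod z"
      using b \<open>z \<noteq> 0\<close> by (simp_all add: norm_divide field_simps)
    ultimately show "poly Q z \<noteq> 0 \<and> cmod l / 2 * cmod z \<le> cmod (F z) \<and> cmod (F z) \<le> (1 + cmod l) / 2 * cmod z"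
      by blast
  qed (use l0 l1 in auto)
qed

section \<open>Convergence from critical values, symmetries, and the case of two roots\<close>

lemma attracting_rational_map_ex:
  obtains R lo up where "attracting_rational_map P Q (roots p) R lo up"
proof -
  obtain R lo up where R: "0 < R" "0 < lo" "0 \<le> up" "up < 1"
    "\<And>z. R \<le> cmod z \<Longrightarrow> poly Q z \<noteq> 0 \<and> lo * cmod z \<le> cmod (F z) \<and> cmod (F z) \<le> up * cmod z"
    using F_near_infinity by blast
  have "attracting_rational_map P Q (roots p) R lo up"
  proof
    fix a assume a: "a \<in> roots p"
    show "poly Q a \<noteq> 0 \<and> F a = a" using root_structure[OF a] by (simp add: F_eq)
  qed (use R two_roots finite_roots deriv_F_at_root in auto)
  then show ?thesis by (rule that)
qed

lemma crit_val_in_each_basin: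
  assumes "a \<in> roots p"
  obtains v where "v \<in> crit_vals" "Some v \<in> basin sphere_map (Some a)"
proof -
  obtain R lo up where "attracting_rational_map P Q (roots p) R lo up"
    using attracting_rational_map_ex .
  then interpret X: attracting_rational_map P Q "roots p" R lo up .
  show ?thesis using X.basin_contains_crit_val[OF assms] that by blast
qed

lemma convergent_if_crit_vals_in_basins:
  assumes "\<And>v. v \<in> crit_vals \<Longrightarrow> \<exists>a\<in>roots p. Some v \<in> basin sphere_map (Some a)"
  shows "convergent_for p h"
proof -
  obtain R lo up where "attracting_rational_map P Q (roots p) R lo up"
    using attracting_rational_map_ex .
  then interpret X: attracting_rational_map P Q "roots p" R lo up .
  show ?thesis
    unfolding convergent_for_def relaxed_newton_eq
    by (rule X.fatou_eq_basins) (use assms in \<open>auto simp: X.basins_def\<close>)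
qed

text \<open>An isometry that commutes with \<open>F\<close> carries orbits to orbits; with a common
  trap radius at \<open>a\<close> and \<open>\<sigma> a\<close>, entry into one trap becomes entry
  into the other.\<close>

lemma basin_isometry:
  assumes iso: "\<And>x y. dist (\<sigma> x) (\<sigma> y) = dist x y"
    and comm: "\<And>z. poly Q z \<noteq> 0 \<Longrightarrow> poly Q (\<sigma> z) \<noteq> 0 \<and> F (\<sigma> z) = \<sigma> (F z)"
    and a: "a \<in> roots p" "\<sigma> a \<in> roots p" and z: "Some z \<in> basin sphere_map (Some a)"
  shows "Some (\<sigma> z) \<in> basin sphere_map (Some (\<sigma> a))"
proof -
  obtain R lo up where "attracting_rational_map P Q (roots p) R lo up"
    using attracting_rational_map_ex .
  then interpret X: attracting_rational_map P Q "roots p" R lo up .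
  have comm_pow: "(sphere_map ^^ k) (Some (\<sigma> z)) = Some (\<sigma> y)"
    if "(sphere_map ^^ k) (Some z) = Some y" for k z y
    using that
  proof (induction k arbitrary: z)
    case (Suc k)
    have Qz: "poly Q z \<noteq> 0"
      using Suc.prems by (auto simp: funpow_Suc_right simp del: funpow.simps)
    then have "(sphere_map ^^ k) (Some (F z)) = Some y"
      using Suc.prems by (simp add: funpow_Suc_right del: funpow.simps)
    then have "(sphere_map ^^ k) (Some (\<sigma> (F z))) = Some (\<sigma> y)" by (rule Suc.IH)
    then show ?case using comm[OF Qz] by (simp add: funpow_Suc_right del: funpow.simps)
  qed auto
  obtain r1 \<kappa>1 where t1: "X.trap a r1 \<kappa>1" using X.trap_exists[OF a(1)] .
  obtain r2 \<kappa>2 where t2: "X.trap (\<sigma> a) r2 \<kappa>2" using X.trap_exists[OF a(2)] .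
  define r where "r = min r1 r2"
  have r: "X.trap a r \<kappa>1" "X.trap (\<sigma> a) r \<kappa>2"
    using X.trapD(1)[OF t1] X.trapD(1)[OF t2]
    by (auto intro!: X.trap_mono[OF t1] X.trap_mono[OF t2] simp: r_def)
  obtain k y where "(sphere_map ^^ k) (Some z) = Some y" "dist y a < r"
    using z X.basin_iff[OF r(1)] by blast
  then have "(sphere_map ^^ k) (Some (\<sigma> z)) = Some (\<sigma> y)" "dist (\<sigma> y) (\<sigma> a) < r"
    using comm_pow iso by auto
  then show ?thesis unfolding X.basin_iff[OF r(2)] by blast
qed

text \<open>Here \<open>P\<close> has degree 2 and \<open>Q\<close> degree 1, so there are at most
  two critical values, and the two disjoint basins already take one each.\<close>

lemma two_roots_convergent:
  assumes "card (roots p) = 2"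
  shows "convergent_for p h"
proof (rule convergent_if_crit_vals_in_basins)
  obtain a b where ab: "roots p = {a, b}" "a \<noteq> b" using assms by (auto simp: card_2_iff)
  obtain u where u: "u \<in> crit_vals" "Some u \<in> basin sphere_map (Some a)"
    using crit_val_in_each_basin[of a] ab by blast
  obtain v where v: "v \<in> crit_vals" "Some v \<in> basin sphere_map (Some b)"
    using crit_val_in_each_basin[of b] ab by blast
  have "u \<noteq> v" using u v basin_disjoint ab(2) by blast
  have "card crit_vals \<le> 2"
    using card_crit_vals_le degree_P degree_Q degree_A assms by simp
  then have "{u, v} = crit_vals"
    using u v \<open>u \<noteq> v\<close> by (intro card_seteq finite_crit_vals) auto
  then show "\<exists>a\<in>roots p. Some w \<in> basin sphere_map (Some a)" if "w \<in> crit_vals" for w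
    using that u v ab by auto
qed

end

section \<open>The family u^m (u^n + c) and its rotational symmetry\<close>

locale rotation_newton = newton +
  fixes a b c :: complex and m n :: nat
  assumes a_nonzero: "a \<noteq> 0" and c_nonzero: "c \<noteq> 0" and n_ge: "n \<ge> 2"
    and p_form: "p = [:b, a:] ^ m * ([:b, a:] ^ n + [:c:])"
begin

definition u :: "complex \<Rightarrow> complex" where "u z = a * z + b"

text \<open>\<open>Q1 / A1\<close> is the logarithmic derivative of \<open>p\<close>; the fraction is reduced exactly if \<open>m > 0\<close>.\<close>

definition A1 :: "complex poly" where "A1 = [:b, a:] * ([:b, a:] ^ n + [:c:])"

definition Q1 :: "complex poly" where
  "Q1 = smult a (smult (of_nat (m + n)) ([:b, a:] ^ n) + [:of_nat m * c:])"

lemma poly_p: "poly p z = u z ^ m * (u z ^ n + c)"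
  by (simp add: p_form u_def poly_power algebra_simps)

lemma poly_A1: "poly A1 z = u z * (u z ^ n + c)"
  by (simp add: A1_def u_def poly_power algebra_simps del: mult_pCons_left)

lemma poly_Q1: "poly Q1 z = a * (of_nat (m + n) * u z ^ n + of_nat m * c)"
  by (simp add: Q1_def u_def poly_power algebra_simps)

text \<open>The factor \<open>of_nat k\<close> covers \<open>k = 0\<close>, where
  \<open>k - 1\<close> is truncated.\<close>

lemma u_mult_power: "of_nat k * u z ^ (k - 1) * u z = of_nat k * u z ^ k"
  by (cases k) auto

lemma poly_pderiv_p:
  "poly (pderiv p) z = a * (of_nat m * u z ^ (m - 1) * (u z ^ n + c) + u z ^ m * (of_nat n * u z ^ (n - 1)))"
  unfolding p_form pderiv_mult pderiv_add pderiv_power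
  by (simp add: pderiv_pCons u_def poly_power algebra_simps)

lemma pderiv_mult_A1: "poly (pderiv p) z * poly A1 z = poly p z * poly Q1 z"
proof -
  have "poly (pderiv p) z * u z =
      a * ((of_nat m * u z ^ (m - 1) * u z) * (u z ^ n + c) + u z ^ m * (of_nat n * u z ^ (n - 1) * u z))"
    unfolding poly_pderiv_p by (simp add: algebra_simps)
  also have "\<dots> = u z ^ m * poly Q1 z"
    unfolding u_mult_power poly_Q1 by (simp add: algebra_simps)
  finally show ?thesis by (simp add: poly_A1 poly_p mult.assoc[symmetric])
qed

lemma Q_A1: "Q * A1 = A * Q1"
proof -
  have "poly (G * (Q * A1)) z = poly (G * (A * Q1)) z" for z
  proof -
    have "poly (G * (Q * A1)) z = poly (G * Q) z * poly A1 z" by simp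
    also have "\<dots> = poly (G * A) z * poly Q1 z" unfolding pderiv_eq p_eq by (rule pderiv_mult_A1)
    finally show ?thesis by simp
  qed
  then have "G * (Q * A1) = G * (A * Q1)" by (simp add: poly_eq_poly_eq_iff[symmetric] fun_eq_iff)
  then show ?thesis using G_nonzero by simp
qed

lemma poly_Q_A1: "poly Q z * poly A1 z = poly A z * poly Q1 z"
  using Q_A1 by (metis poly_mult)

text \<open>For \<open>m = 0\<close> the centre is a zero of the derivative but not of
  \<open>p\<close>, hence a pole of the Newton map. This removes one candidate for a critical
  point.\<close>

lemma Q_zero_center:
  assumes "m = 0" "u z = 0"
  shows "poly Q z = 0"
proof -
  have "poly (pderiv p) z = 0" using assms n_ge by (simp add: poly_pderiv_p)
  then have "poly G z * poly Q z = 0" by (metis pderiv_eq poly_mult)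
  moreover have "poly p z \<noteq> 0" using assms n_ge c_nonzero by (simp add: poly_p power_0_left)
  then have "poly G z \<noteq> 0" using p_eq by (metis mult_zero_left poly_mult)
  ultimately show ?thesis by simp
qed

text \<open>A zero of \<open>Q1\<close> off the poles would be a zero of \<open>A1\<close>. Where
  u^n = -c the value of \<open>Q1\<close> is -a n c, and at the centre it vanishes only for
  \<open>m = 0\<close>, when the centre is a pole.\<close>

lemma Q1_nonzero:
  assumes Q: "poly Q z \<noteq> 0"
  shows "poly Q1 z \<noteq> 0"
proof
  assume Q1: "poly Q1 z = 0"
  then have "poly A1 z = 0" using poly_Q_A1[of z] Q by simp
  then consider "u z = 0" | "u z ^ n = - c" by (auto simp: poly_A1 add_eq_0_iff2)
  then show False
  proof cases
    case 1
    then have "m = 0" using Q1 a_nonzero c_nonzero n_ge by (simp add: poly_Q1 power_0_left)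
    then show ?thesis using Q_zero_center 1 Q by blast
  next
    case 2
    then have "of_nat n * c = 0" using Q1 a_nonzero by (simp add: poly_Q1 algebra_simps)
    then show ?thesis using c_nonzero n_ge by simp
  qed
qed

lemma A_over_Q:
  assumes Q: "poly Q z \<noteq> 0"
  shows "poly A z / poly Q z = poly A1 z / poly Q1 z"
  using Q1_nonzero[OF Q] Q poly_Q_A1[of z] by (simp add: field_simps)

lemma F_eq_A1_Q1:
  assumes Q: "poly Q z \<noteq> 0"
  shows "F z = z - h * (poly A1 z / poly Q1 z)"
  unfolding A_over_Q[OF Q, symmetric] using F_eq[OF Q] by simp

text \<open>The derivative of \<open>F\<close> depends on \<open>v = u z ^ n\<close> only, and its numerator is quadratic in \<open>v\<close>.\<close>

lemma wronskian_quadratic: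
  assumes Q: "poly Q z \<noteq> 0" and W: "poly wronskian z = 0" and v: "v = u z ^ n"
  shows "poly [:of_nat m * c\<^sup>2 * (of_nat m - h),
      2 * of_nat (m + n) * of_nat m * c - h * (of_nat (n + 1) * of_nat m * c + c * of_nat (m + n) - c * of_nat (m + n) * of_nat n),
      of_nat (m + n) * (of_nat (m + n) - h):] v = 0"
proof -
  define dA1 dQ1 where "dA1 = poly (pderiv A1) z" and "dQ1 = poly (pderiv Q1) z"
  have "pderiv (Q * A1) = pderiv (A * Q1)" by (simp add: Q_A1)
  then have d: "poly (pderiv Q) z * poly A1 z + poly Q z * dA1 = poly (pderiv A) z * poly Q1 z + poly A z * dQ1"
    unfolding dA1_def dQ1_def by (metis (no_types, lifting) add.commute mult.commute pderiv_mult poly_add poly_mult)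
  have e: "poly Q z * poly A1 z = poly A z * poly Q1 z" by (rule poly_Q_A1)
  \<comment> \<open>The derivatives of A1 / Q1 and A / Q agree; this is that equality with
    denominators cleared, so the Wronskian condition can be read off \<open>A1\<close> and
    \<open>Q1\<close>.\<close>
  have "(dA1 * poly Q1 z - poly A1 z * dQ1) * (poly Q z)\<^sup>2
      = (poly (pderiv A) z * poly Q z - poly A z * poly (pderiv Q) z) * (poly Q1 z)\<^sup>2"
    using d e by algebra
  then have "((poly Q1 z)\<^sup>2 - h * (dA1 * poly Q1 z - poly A1 z * dQ1)) * (poly Q z)\<^sup>2 = poly wronskian z * (poly Q1 z)\<^sup>2"
    unfolding poly_wronskian by algebra
  then have W1: "(poly Q1 z)\<^sup>2 - h * (dA1 * poly Q1 z - poly A1 z * dQ1) = 0" using W Q by simp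
  have "dA1 = a * (u z ^ n + c) + u z * (of_nat n * u z ^ (n - 1) * a)"
    unfolding dA1_def A1_def
    by (simp add: pderiv_mult pderiv_add pderiv_power pderiv_pCons u_def poly_power algebra_simps del: mult_pCons_left)
  also have "\<dots> = a * (of_nat (n + 1) * v + c)"
    using u_mult_power[of n z] v by (simp add: algebra_simps)
  finally have dA1: "dA1 = a * (of_nat (n + 1) * v + c)" .
  have "dQ1 = a * (of_nat (m + n) * (of_nat n * u z ^ (n - 1) * a))"
    unfolding dQ1_def Q1_def
    by (simp add: pderiv_add pderiv_smult pderiv_power pderiv_pCons u_def poly_power algebra_simps)
  then have "poly A1 z * dQ1 = (of_nat n * u z ^ (n - 1) * u z) * (v + c) * a * a * of_nat (m + n)"
    by (simp add: poly_A1 v algebra_simps)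
  also have "\<dots> = of_nat n * v * (v + c) * a * a * of_nat (m + n)"
    unfolding u_mult_power v ..
  finally have dQ1: "poly A1 z * dQ1 = of_nat n * v * (v + c) * a * a * of_nat (m + n)" .
  have Q1: "poly Q1 z = a * (of_nat (m + n) * v + of_nat m * c)" by (simp add: poly_Q1 v)
  define M N :: complex where "M = of_nat m" and "N = of_nat n"
  have "a\<^sup>2 * (((M + N) * v + M * c)\<^sup>2 - h * (((N + 1) * v + c) * ((M + N) * v + M * c) - N * v * (v + c) * (M + N))) = 0"
    using W1 unfolding dQ1 dA1 Q1 M_def N_def of_nat_add of_nat_1 by (simp add: power2_eq_square algebra_simps)
  then have "((M + N) * v + M * c)\<^sup>2 - h * (((N + 1) * v + c) * ((M + N) * v + M * c) - N * v * (v + c) * (M + N)) = 0"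
    using a_nonzero by simp
  then show ?thesis
    by (simp add: M_def[symmetric] N_def[symmetric] power2_eq_square algebra_simps)
qed

lemma m_plus_n_neq_h: "of_nat (m + n) \<noteq> h"
proof -
  have "degree p = degree ([:b, a:] ^ m) + degree ([:b, a:] ^ n + [:c:])"
  proof -
    have "[:b, a:] ^ m \<noteq> 0" using a_nonzero by simp
    moreover have "[:b, a:] ^ n + [:c:] \<noteq> 0" using p_nonzero p_form by auto
    ultimately show ?thesis unfolding p_form by (rule degree_mult_eq)
  qed
  also have "degree ([:b, a:] ^ m) = m" using a_nonzero by (simp add: degree_power_eq)
  also have "degree ([:b, a:] ^ n + [:c:]) = n"
    using a_nonzero n_ge by (subst degree_add_eq_left) (auto simp: degree_power_eq)
  finally show ?thesis using degree_p_neq_h by simp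
qed

text \<open>The map that \<open>F\<close> induces on v = u z ^ n, the coordinate on the quotient by
  the rotations of order n about the centre.\<close>

definition \<psi> :: "complex \<Rightarrow> complex" where
  "\<psi> v = v * (1 - h * (v + c) / (of_nat (m + n) * v + of_nat m * c)) ^ n"

lemma u_F:
  assumes Q: "poly Q z \<noteq> 0"
  shows "u (F z) ^ n = \<psi> (u z ^ n)"
proof -
  have "u (F z) = u z - a * h * (poly A z / poly Q z)"
    unfolding u_def F_eq[OF Q] by (simp add: algebra_simps)
  also have "\<dots> = u z * (1 - h * (u z ^ n + c) / (of_nat (m + n) * u z ^ n + of_nat m * c))"
  proof -
    have "a * h * (u z * x / (a * y)) = u z * (h * x / y)" for x y
      using a_nonzero by simp
    then show ?thesis unfolding A_over_Q[OF Q] poly_A1 poly_Q1 by (simp only: right_diff_distrib mult_1_right)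
  qed
  finally show ?thesis by (simp add: \<psi>_def power_mult_distrib)
qed

definition crit_classes :: "complex set" where "crit_classes = (\<lambda>w. u w ^ n) ` crit_vals"

text \<open>Critical points have v among the roots of a quadratic, hence at most two classes. For
  \<open>m = 0\<close> its constant coefficient vanishes, and the root 0 belongs to the centre, a
  pole, so one class is left.\<close>

lemma card_crit_classes: "card crit_classes \<le> (if m = 0 then 1 else 2)"
proof -
  define q0 q1 q2 where "q0 = of_nat m * c\<^sup>2 * (of_nat m - h)"
    and "q1 = 2 * of_nat (m + n) * of_nat m * c - h * (of_nat (n + 1) * of_nat m * c + c * of_nat (m + n) - c * of_nat (m + n) * of_nat n)"
    and "q2 = of_nat (m + n) * (of_nat (m + n) - h)"
  have q2: "q2 \<noteq> 0" using m_plus_n_neq_h n_ge by (simp add: q2_def del: of_nat_add)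
  define X where "X = {v. poly [:q0, q1, q2:] v = 0 \<and> (m = 0 \<longrightarrow> v \<noteq> 0)}"
  have "crit_classes \<subseteq> \<psi> ` X"
  proof
    fix t assume "t \<in> crit_classes"
    then obtain z where z: "t = u (F z) ^ n" "poly wronskian z = 0" "poly Q z \<noteq> 0"
      using crit_vals_subset by (auto simp: crit_classes_def)
    have "u z ^ n \<noteq> 0" if "m = 0" using Q_zero_center[OF that, of z] z(3) by auto
    then have "u z ^ n \<in> X"
      using wronskian_quadratic[OF z(3,2) refl] unfolding X_def q0_def q1_def q2_def by blast
    then show "t \<in> \<psi> ` X" using u_F[OF z(3)] z(1) by blast
  qed
  moreover have X: "finite X" "card X \<le> (if m = 0 then 1 else 2)"
  proof -
    have q: "[:q0, q1, q2:] \<noteq> 0" using q2 by simp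
    have sub: "X \<subseteq> {v. poly [:q0, q1, q2:] v = 0}" by (auto simp: X_def)
    show fin: "finite X" using finite_subset[OF sub poly_roots_finite[OF q]] .
    show "card X \<le> (if m = 0 then 1 else 2)"
    proof (cases "m = 0")
      case True
      have "v = - q1 / q2" if "v \<in> X" for v
      proof -
        have "v * (q1 + v * q2) = 0" "v \<noteq> 0" using that True by (auto simp: X_def q0_def)
        then have "v * q2 = - q1" by (simp add: add_eq_0_iff)
        then show ?thesis using q2 by (simp add: field_simps)
      qed
      then have "X \<subseteq> {- q1 / q2}" by blast
      then have "card X \<le> card {- q1 / q2}" by (intro card_mono) auto
      then show ?thesis using True by simp
    next
      case False
      have "card X \<le> card {v. poly [:q0, q1, q2:] v = 0}"
        by (rule card_mono[OF poly_roots_finite[OF q] sub])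
      also have "\<dots> \<le> degree [:q0, q1, q2:]" by (rule card_poly_roots_bound[OF q])
      also have "\<dots> \<le> 2" by simp
      finally show ?thesis using False by simp
    qed
  qed
  ultimately show ?thesis
    using card_mono[of "\<psi> ` X" crit_classes] card_image_le[of X \<psi>] by simp
qed

text \<open>Multiplication by \<omega> in the coordinate \<open>u\<close>; it fixes the centre -b /
  a.\<close>

definition rot :: "complex \<Rightarrow> complex \<Rightarrow> complex" where
  "rot \<omega> z = \<omega> * z + (\<omega> - 1) * b / a"

lemma u_rot: "u (rot \<omega> z) = \<omega> * u z"
  using a_nonzero by (simp add: u_def rot_def field_simps)

lemma u_inj: "inj u"
  using a_nonzero by (simp add: inj_def u_def)

text \<open>For an n-th root of unity \<open>A1\<close> is multiplied by \<omega> and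
  \<open>Q1\<close> is unchanged, so the rotation commutes with the Newton map.\<close>

lemma basin_rot:
  assumes \<omega>: "\<omega> ^ n = 1" and r: "r \<in> roots p" "Some z \<in> basin sphere_map (Some r)"
  shows "rot \<omega> r \<in> roots p" "Some (rot \<omega> z) \<in> basin sphere_map (Some (rot \<omega> r))"
proof -
  show root: "rot \<omega> r \<in> roots p"
    using r(1) \<omega> by (auto simp: roots_def poly_p u_rot power_mult_distrib)
  have norm: "cmod \<omega> = 1"
  proof -
    have "cmod \<omega> ^ n = 1 ^ n" using \<omega> by (metis norm_one norm_power power_one)
    then show ?thesis by (rule power_eq_imp_eq_base) (use n_ge in auto)
  qed
  show "Some (rot \<omega> z) \<in> basin sphere_map (Some (rot \<omega> r))"
  proof (rule basin_isometry[of "rot \<omega>", OF _ _ r(1) root r(2)])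
    fix x y
    have "rot \<omega> x - rot \<omega> y = \<omega> * (x - y)" by (simp add: rot_def algebra_simps)
    then show "dist (rot \<omega> x) (rot \<omega> y) = dist x y" by (simp add: dist_norm norm_mult norm)
  next
    fix z assume Q: "poly Q z \<noteq> 0"
    have A1: "poly A1 (rot \<omega> z) = \<omega> * poly A1 z" and Q1: "poly Q1 (rot \<omega> z) = poly Q1 z"
      using \<omega> by (simp_all add: poly_A1 poly_Q1 u_rot power_mult_distrib)
    have Qr: "poly Q (rot \<omega> z) \<noteq> 0"
    proof
      assume 0: "poly Q (rot \<omega> z) = 0"
      then have "poly A (rot \<omega> z) = 0"
        using poly_Q_A1[of "rot \<omega> z"] Q1 Q1_nonzero[OF Q] by simp
      then show False using no_common_root_A_Q 0 by blast
    qed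
    have "F (rot \<omega> z) = rot \<omega> z - h * (\<omega> * (poly A1 z / poly Q1 z))"
      unfolding F_eq_A1_Q1[OF Qr] A1 Q1 by simp
    also have "\<dots> = rot \<omega> (z - h * (poly A1 z / poly Q1 z))" by (simp add: rot_def algebra_simps)
    also have "z - h * (poly A1 z / poly Q1 z) = F z" by (rule F_eq_A1_Q1[OF Q, symmetric])
    finally show "poly Q (rot \<omega> z) \<noteq> 0 \<and> F (rot \<omega> z) = rot \<omega> (F z)" using Qr by blast
  qed
qed

text \<open>Equal n-th powers differ by a root of unity. Hence a critical value lies in some basin
  as soon as another one of its class does.\<close>

lemma same_class_rot:
  assumes "u x ^ n = u y ^ n"
  obtains \<omega> where "\<omega> ^ n = 1" "x = rot \<omega> y"
proof (cases "u y = 0")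
  case True
  then have ux: "u x = 0" using assms n_ge by (simp add: power_0_left)
  have "x = rot 1 y" by (rule injD[OF u_inj]) (simp add: True ux u_rot)
  then show ?thesis using that[of 1] by simp
next
  case False
  then have "(u x / u y) ^ n = 1" using assms by (simp add: power_divide)
  moreover have "x = rot (u x / u y) y" by (rule injD[OF u_inj]) (simp add: False u_rot)
  ultimately show ?thesis by (rule that)
qed

text \<open>A root with u^n = -c accounts for one class of critical values. For \<open>m = 0\<close>
  that is the only class; otherwise the centre is a root too, and its basin accounts for the
  second.\<close>

lemma convergent: "convergent_for p h"
proof (rule convergent_if_crit_vals_in_basins)
  fix w assume w: "w \<in> crit_vals"
  have fin: "finite crit_classes" unfolding crit_classes_def using finite_crit_vals by simp
  have class_in: "u v ^ n \<in> crit_classes" if "v \<in> crit_vals" for v using that by (simp add: crit_classes_def)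
  have finish: "\<exists>r\<in>roots p. Some w \<in> basin sphere_map (Some r)"
    if r: "r \<in> roots p" "Some v \<in> basin sphere_map (Some r)" "u w ^ n = u v ^ n" for r v
  proof -
    obtain \<omega> where \<omega>: "\<omega> ^ n = 1" "w = rot \<omega> v" using same_class_rot[OF r(3)] .
    then show ?thesis using basin_rot[OF \<omega>(1) r(1,2)] by blast
  qed
  obtain \<zeta> where \<zeta>: "\<zeta> ^ n = - c"
  proof -
    have "card {z. z ^ n = - c} = n" using c_nonzero n_ge by (intro card_nth_roots) auto
    then have "{z. z ^ n = - c} \<noteq> {}" using n_ge by (metis card.empty not_numeral_le_zero)
    then show ?thesis using that by blast
  qed
  define r where "r = (\<zeta> - b) / a"
  have ur: "u r = \<zeta>" using a_nonzero by (simp add: u_def r_def)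
  have r: "r \<in> roots p" using \<zeta> by (simp add: roots_def poly_p ur)
  obtain v where v: "v \<in> crit_vals" "Some v \<in> basin sphere_map (Some r)"
    using crit_val_in_each_basin[OF r] .
  show "\<exists>r\<in>roots p. Some w \<in> basin sphere_map (Some r)"
  proof (cases "m = 0")
    case True
    then have "card crit_classes \<le> 1" using card_crit_classes by simp
    then have "u w ^ n = u v ^ n"
      using class_in[OF w] class_in[OF v(1)] fin by (metis card_le_Suc0_iff_eq One_nat_def)
    then show ?thesis by (rule finish[OF r v(2)])
  next
    case False
    define o' where "o' = - b / a"
    have uo: "u o' = 0" using a_nonzero by (simp add: u_def o'_def)
    have o': "o' \<in> roots p" using False by (simp add: roots_def poly_p uo)
    obtain v' where v': "v' \<in> crit_vals" "Some v' \<in> basin sphere_map (Some o')"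
      using crit_val_in_each_basin[OF o'] .
    \<comment> \<open>These rotations fix the centre and preserve its basin, so a critical value in
      the basin of \<open>r\<close> is not a rotate of one in the basin of the centre.\<close>
    have neq: "u v ^ n \<noteq> u v' ^ n"
    proof
      assume "u v ^ n = u v' ^ n"
      then obtain \<omega> where \<omega>: "\<omega> ^ n = 1" "v = rot \<omega> v'" by (rule same_class_rot)
      have "rot \<omega> o' = o'" by (rule injD[OF u_inj]) (simp add: uo u_rot)
      then have "Some v \<in> basin sphere_map (Some o')" using basin_rot(2)[OF \<omega>(1) o' v'(2)] \<omega>(2) by simp
      then have "r = o'" using v(2) basin_disjoint by blast
      then have "\<zeta> = 0" using ur uo by simp
      then show False using \<zeta> c_nonzero n_ge by (simp add: power_0_left)
    qed
    have "card crit_classes \<le> 2" using card_crit_classes False by simp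
    then have "{u v ^ n, u v' ^ n} = crit_classes"
      using class_in v(1) v'(1) neq by (intro card_seteq fin) auto
    then consider "u w ^ n = u v ^ n" | "u w ^ n = u v' ^ n" using class_in[OF w] by blast
    then show ?thesis by cases (auto intro: finish[OF r v(2)] finish[OF o' v'(2)])
  qed
qed

end

section \<open>The three classes of polynomials\<close>

lemma rotation_form_convergent:
  fixes a b c :: complex
  assumes "a \<noteq> 0" "c \<noteq> 0" "n \<ge> 2"
  shows "h_convergent ([:b, a:] ^ m * ([:b, a:] ^ n + [:c:]))"
  unfolding h_convergent_def
proof (intro allI impI)
  define p where "p = [:b, a:] ^ m * ([:b, a:] ^ n + [:c:])"
  fix h assume adm: "admissible ([:b, a:] ^ m * ([:b, a:] ^ n + [:c:])) h"
  have root: "(\<zeta> - b) / a \<in> roots p" if "\<zeta> ^ n = - c" for \<zeta>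
    using that assms(1) by (simp add: roots_def p_def poly_power)
  \<comment> \<open>The \<open>n\<close> distinct solutions, with \<open>n\<close> at least 2,
    provide the two different roots that \<open>newton\<close> requires.\<close>
  have card: "card {z. z ^ n = - c} = n" using assms by (intro card_nth_roots) auto
  have "rotation_newton p h a b c m n"
  proof
    have "degree ([:b, a:] ^ n + [:c:]) = n"
      using assms by (subst degree_add_eq_left) (auto simp: degree_power_eq)
    then have "[:b, a:] ^ n + [:c:] \<noteq> 0" using assms(3) by (metis degree_0 not_numeral_le_zero)
    then show "p \<noteq> 0" using assms(1) by (simp add: p_def)
    show "\<exists>r\<in>roots p. r \<noteq> x" for x
    proof (rule ccontr)
      assume no: "\<not> ?thesis"
      have "{z. z ^ n = - c} \<subseteq> {a * x + b}"
      proof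
        fix \<zeta> assume "\<zeta> \<in> {z. z ^ n = - c}"
        then have "(\<zeta> - b) / a = x" using root no by blast
        then show "\<zeta> \<in> {a * x + b}" using assms(1) by (auto simp: field_simps)
      qed
      then have "card {z. z ^ n = - c} \<le> card {a * x + b}" by (intro card_mono) auto
      then show False using card assms(3) by simp
    qed
  qed (use adm assms p_def in auto)
  then show "convergent_for ([:b, a:] ^ m * ([:b, a:] ^ n + [:c:])) h"
    using rotation_newton.convergent unfolding p_def by blast
qed

theorem theoremA:
  fixes p :: "complex poly"
  assumes "(p \<noteq> 0 \<and> card (roots p) = 2)
         \<or> (\<exists>\<alpha> \<beta> n. \<beta> \<noteq> 0 \<and> n \<ge> 2 \<and> p = [:-\<alpha>, 1:] ^ n + [:\<beta>:])
         \<or> (\<exists>a b c m n. a \<noteq> 0 \<and> c \<noteq> 0 \<and> n \<ge> 2 \<and>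
               p = [:b, a:] ^ m * ([:b, a:] ^ n + [:c:]))"
  shows "h_convergent p"
  using assms
proof (elim disjE exE conjE)
  assume p: "p \<noteq> 0" "card (roots p) = 2"
  show ?thesis
    unfolding h_convergent_def
  proof (intro allI impI)
    fix h assume "admissible p h"
    moreover have "\<exists>b\<in>roots p. b \<noteq> a" for a
      using p(2) by (auto simp: card_2_iff)
    ultimately interpret newton p h using p(1) by unfold_locales auto
    show "convergent_for p h" using p(2) by (rule two_roots_convergent)
  qed
next
  fix \<alpha> \<beta> :: complex and n :: nat assume "\<beta> \<noteq> 0" "n \<ge> 2" "p = [:-\<alpha>, 1:] ^ n + [:\<beta>:]"
  \<comment> \<open>The unicritical case is the form with \<open>m = 0\<close>, a = 1 and b =
    -\<alpha>.\<close>
  then show ?thesis using rotation_form_convergent[of 1 \<beta> n "-\<alpha>" 0] by simp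
next
  fix a b c :: complex and m n :: nat
  assume "a \<noteq> 0" "c \<noteq> 0" "n \<ge> 2" "p = [:b, a:] ^ m * ([:b, a:] ^ n + [:c:])"
  then show ?thesis using rotation_form_convergent[of a c n b m] by simp
qed

end
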